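(* Let $n,k_1,k_2,t$ be positive integers with $n\geq\max\{t+1,\,k_2-t\}\cdot(t+1)(k_1-t+1)(k_2-t+1)+t+1$, $k_1\geq k_2\geq t+1$ and $(k_1,k_2,t)\notin\{(2,2,1),(3,2,1),(4,2,1),(4,4,2)\}$. Let $\mathcal{F}_1\subseteq\binom{[n]}{k_1}$ and $\mathcal{F}_2\subseteq\binom{[n]}{k_2}$ be non-trivial cross $t$-intersecting families. (i) If $k_2\geq 2t+1$, then $$|\mathcal{F}_1||\mathcal{F}_2|\leq\left(\binom{n-t}{k_1-t}-\binom{n-k_2-1}{k_1-t}\right)\left(\binom{n-t}{k_2-t}+t\right),$$ and equality holds only if there exist a $t$-subset $X$ and a $(k_2+1)$-subset $M$ of $[n]$ with $X\subseteq M$ such that either (a) $\mathcal{F}_1=\{F\in\binom{[n]}{k_1}: X\subseteq F,\ |F\cap M|\geq t+1\}$ and $\mathcal{F}_2=\{F\in\binom{[n]}{k_2}: X\subseteq F\}\cup\binom{M}{k_2}$, or (b) $k_1=k_2$, $\mathcal{F}_1=\{F\in\binom{[n]}{k_1}: X\subseteq F\}\cup\binom{M}{k_1}$ and $\mathcal{F}_2=\{F\in\binom{[n]}{k_2}: X\subseteq F,\ |F\cap M|\geq t+1\}$. (ii) If $t+1\leq k_2\leq 2t$, then $$|\mathcal{F}_1||\mathcal{F}_2|\leq\binom{n-t-1}{k_1-t-1}\left((t+1)\binom{n-t-1}{k_2-t}+\binom{n-t-1}{k_2-t-1}\right),$$ and equality holds only if there exists a $(t+1)$-subset $T$ of $[n]$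 such that either (a) $\mathcal{F}_1=\{F\in\binom{[n]}{k_1}: T\subseteq F\}$ and $\mathcal{F}_2=\{F\in\binom{[n]}{k_2}: |F\cap T|\geq t\}$, or (b) $k_1=k_2$, $\mathcal{F}_1=\{F\in\binom{[n]}{k_1}: |F\cap T|\geq t\}$ and $\mathcal{F}_2=\{F\in\binom{[n]}{k_2}: T\subseteq F\}$.
   Context: $[n]=\{1,\dots,n\}$; $\binom{V}{k}$ is the family of $k$-subsets of $V$. Families $\mathcal{F}_1\subseteq\binom{[n]}{k_1}$, $\mathcal{F}_2\subseteq\binom{[n]}{k_2}$ are cross $t$-intersecting if $|F_1\cap F_2|\geq t$ for all $F_1\in\mathcal{F}_1$, $F_2\in\mathcal{F}_2$; they are trivial if $|\bigcap_{F\in\mathcal{F}_1}F\cap\bigcap_{F\in\mathcal{F}_2}F|\geq t$, and non-trivial otherwise. Binomial coefficients $\binom{a}{b}$ are $0$ when $b<0$ or $b>a$. *)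

theory Defs
  imports "HOL-Library.Ramsey"
begin

text \<open>
  The family of all \<open>k\<close>-subsets of \<open>V\<close> is \<open>[V]\<^bsup>k\<^esup>\<close>, i.e. \<^const>\<open>nsets\<close> from
  \<^theory>\<open>HOL-Library.Ramsey\<close>.
\<close>

definition cross_intersecting :: "nat \<Rightarrow> 'a set set \<Rightarrow> 'a set set \<Rightarrow> bool" where
  "cross_intersecting t \<F>\<^sub>1 \<F>\<^sub>2 \<longleftrightarrow> (\<forall>F\<^sub>1\<in>\<F>\<^sub>1. \<forall>F\<^sub>2\<in>\<F>\<^sub>2. t \<le> card (F\<^sub>1 \<inter> F\<^sub>2))"

text \<open>
  Intersections are taken inside the ground set \<open>V\<close>, so that an empty family has intersection
  \<open>V\<close>. (In HOL, \<open>\<Inter>{} = UNIV\<close>, and \<^const>\<open>card\<close> of an infinite set is \<open>0\<close>.)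
  If one of the families is a nonempty family of subsets of \<open>V\<close>, the factor \<open>V\<close> has no effect.
\<close>

definition trivial_pair :: "'a set \<Rightarrow> nat \<Rightarrow> 'a set set \<Rightarrow> 'a set set \<Rightarrow> bool" where
  "trivial_pair V t \<F>\<^sub>1 \<F>\<^sub>2 \<longleftrightarrow> t \<le> card (V \<inter> (\<Inter>\<F>\<^sub>1 \<inter> \<Inter>\<F>\<^sub>2))"

end

theory Submission
  imports Defs Complex_Main
begin

text \<open>
  Call \<open>T\<close> a \<open>t\<close>-cover of a family if it meets every member in at least \<open>t\<close> elements; members of one
  family are \<open>t\<close>-covers of the other. Let \<open>t + i\<close> and \<open>t + j\<close> be the least sizes of \<open>t\<close>-covers of
  \<open>\<F>\<^sub>2\<close> and \<open>\<F>\<^sub>1\<close>. A set that is not a \<open>t\<close>-cover of \<open>\<F>\<^sub>2\<close> can be enlarged in at most \<open>k\<^sub>2 - t + 1\<close>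
  ways to stay inside a member of \<open>\<F>\<^sub>1\<close>; iterating this from the \<open>t\<close>-subsets of a minimal cover bounds
  both sizes, and each unit of \<open>i\<close> or \<open>j\<close> costs a factor of order \<open>1 / n\<close>. Everything but
  \<open>(i, j) = (1, 0)\<close> and \<open>(0, 1)\<close> is then too small (\<open>(0, 0)\<close> because the pair is non-trivial).

  If \<open>(i, j) = (1, 0)\<close>, all of \<open>\<F>\<^sub>1\<close> contains a \<open>t\<close>-set \<open>X\<close>. Let \<open>A\<close> be the set of all \<open>y\<close> such that \<open>X \<union> {y}\<close> is
  a \<open>t\<close>-cover of \<open>\<F>\<^sub>2\<close>. If \<open>A\<close> has the largest possible size \<open>k\<^sub>2 - t + 1\<close>, the families lie in the first
  extremal configuration with \<open>M = X \<union> A\<close>; if some \<open>y \<in> A\<close> lies in all of \<open>\<F>\<^sub>1\<close>, they lie in the second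
  one with \<open>T = X \<union> {y}\<close>; otherwise the product is too small. It remains to compare the extremal products
  of both types and both orders of \<open>k\<^sub>1\<close> and \<open>k\<^sub>2\<close>.
\<close>

section \<open>Covers and branching\<close>

definition star :: "'a set \<Rightarrow> nat \<Rightarrow> 'a set \<Rightarrow> 'a set set" where
  "star V k S = {F \<in> [V]\<^bsup>k\<^esup>. S \<subseteq> F}"

definition t_cover :: "nat \<Rightarrow> 'a set set \<Rightarrow> 'a set \<Rightarrow> bool" where
  "t_cover t \<F> T \<longleftrightarrow> (\<forall>A\<in>\<F>. t \<le> card (T \<inter> A))"

lemma finite_star: "finite V \<Longrightarrow> finite (star V k S)"
  by (simp add: star_def finite_imp_finite_nsets)

text \<open>Removing \<open>S\<close> is a bijection onto the \<open>(k - card S)\<close>-subsets of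
  \<open>V - S - A\<close>.\<close>

lemma card_superset_disjoint:
  assumes "finite V" "S \<subseteq> V" "A \<subseteq> V" "S \<inter> A = {}" "card S \<le> k"
  shows "card {F \<in> [V]\<^bsup>k\<^esup>. S \<subseteq> F \<and> F \<inter> A = {}} = (card V - card S - card A) choose (k - card S)"
proof -
  have fS: "finite S" "finite A" using assms(1-3) by (auto intro: finite_subset)
  have "bij_betw (\<lambda>F. F - S) {F \<in> [V]\<^bsup>k\<^esup>. S \<subseteq> F \<and> F \<inter> A = {}} ([V - S - A]\<^bsup>(k - card S)\<^esup>)"
  proof (rule bij_betwI[where g = "\<lambda>G. G \<union> S"])
    show "(\<lambda>F. F - S) \<in> {F \<in> [V]\<^bsup>k\<^esup>. S \<subseteq> F \<and> F \<inter> A = {}} \<rightarrow> [V - S - A]\<^bsup>(k - card S)\<^esup>"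
    proof
      fix F assume "F \<in> {F \<in> [V]\<^bsup>k\<^esup>. S \<subseteq> F \<and> F \<inter> A = {}}"
      then have F: "F \<subseteq> V" "finite F" "card F = k" "S \<subseteq> F" "F \<inter> A = {}" by (auto simp: nsets_def)
      then have "card (F - S) = k - card S" using fS by (simp add: card_Diff_subset)
      moreover have "F - S \<subseteq> V - S - A" using F by blast
      ultimately show "F - S \<in> [V - S - A]\<^bsup>(k - card S)\<^esup>" using F(2) by (simp add: nsets_def)
    qed
    show "(\<lambda>G. G \<union> S) \<in> [V - S - A]\<^bsup>(k - card S)\<^esup> \<rightarrow> {F \<in> [V]\<^bsup>k\<^esup>. S \<subseteq> F \<and> F \<inter> A = {}}"
    proof
      fix G assume "G \<in> [V - S - A]\<^bsup>(k - card S)\<^esup>"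
      then have G: "G \<subseteq> V - S - A" "finite G" "card G = k - card S" by (auto simp: nsets_def)
      then have "card (G \<union> S) = k" using fS assms(5) by (subst card_Un_disjoint) auto
      moreover have "G \<union> S \<subseteq> V" "(G \<union> S) \<inter> A = {}" using G assms(2,4) by blast+
      ultimately show "G \<union> S \<in> {F \<in> [V]\<^bsup>k\<^esup>. S \<subseteq> F \<and> F \<inter> A = {}}"
        using G(2) fS by (simp add: nsets_def)
    qed
    show "F - S \<union> S = F" if "F \<in> {F \<in> [V]\<^bsup>k\<^esup>. S \<subseteq> F \<and> F \<inter> A = {}}" for F
      using that by blast
    show "G \<union> S - S = G" if "G \<in> [V - S - A]\<^bsup>(k - card S)\<^esup>" for G
      using that by (force simp: nsets_def)
  qed
  then have "card {F \<in> [V]\<^bsup>k\<^esup>. S \<subseteq> F \<and> F \<inter> A = {}} = card (V - S - A) choose (k - card S)"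
    by (simp add: bij_betw_same_card card_nsets)
  also have "card (V - S - A) = card V - card S - card A"
  proof -
    have "A \<subseteq> V - S" using assms by auto
    then show ?thesis using assms fS by (simp add: card_Diff_subset)
  qed
  finally show ?thesis .
qed

lemma card_superset:
  assumes "finite V" "S \<subseteq> V" "card S \<le> k"
  shows "card {F \<in> [V]\<^bsup>k\<^esup>. S \<subseteq> F} = (card V - card S) choose (k - card S)"
  using card_superset_disjoint[of V S "{}" k] assms by simp

text \<open>Choosing the complement makes the count \<open>0\<close> as soon as \<open>card S > k\<close>.\<close>

lemma card_star:
  assumes "finite V" "S \<subseteq> V" "k \<le> card V"
  shows "card (star V k S) = (card V - card S) choose (card V - k)"
proof (cases "card S \<le> k")
  case True
  have "card (star V k S) = (card V - card S) choose (k - card S)"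
    using card_superset assms True by (simp add: star_def)
  also have "\<dots> = (card V - card S) choose (card V - card S - (k - card S))"
    by (rule binomial_symmetric) (use assms in auto)
  finally show ?thesis using True by simp
next
  case False
  have "star V k S = {}"
    using False assms by (auto simp: star_def nsets_def dest: card_mono)
  moreover have "card S \<le> card V" using assms by (intro card_mono)
  ultimately show ?thesis using False assms by (simp add: binomial_eq_0)
qed

text \<open>Only \<open>q - t + 1\<close> elements of \<open>G\<close> have to be tried: \<open>D\<close> omits just \<open>t - 1\<close> elements of \<open>G\<close>,
  so every \<open>F\<close> with \<open>card (F \<inter> G) \<ge> t\<close> meets \<open>D\<close>.\<close>

lemma branching:
  assumes "G \<in> [V]\<^bsup>q\<^esup>" "card (S \<inter> G) < t" "t \<le> q"
  obtains D where "D \<subseteq> G - S" "card D = q - t + 1" "finite D"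
    "\<And>F. t \<le> card (F \<inter> G) \<Longrightarrow> F \<inter> D \<noteq> {}"
proof -
  have G: "finite G" "card G = q" using assms by (auto simp: nsets_def)
  have "card (G - S) = q - card (S \<inter> G)"
    using G by (metis card_Diff_subset_Int finite_Int inf_commute)
  then have "q - t + 1 \<le> card (G - S)" using assms by linarith
  then obtain D where D: "D \<subseteq> G - S" "card D = q - t + 1" "finite D"
    using obtain_subset_with_card_n by metis
  have "F \<inter> D \<noteq> {}" if "t \<le> card (F \<inter> G)" for F
  proof
    assume "F \<inter> D = {}"
    then have "F \<inter> G \<subseteq> G - D" by auto
    then have "card (F \<inter> G) \<le> card (G - D)" using G by (intro card_mono) auto
    also have "\<dots> = q - (q - t + 1)" using D G by (subst card_Diff_subset) auto
    also have "\<dots> < t" using assms that G by linarith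
    finally show False using that by simp
  qed
  with D that show thesis by blast
qed

lemma card_le_branching:
  assumes "finite \<F>" "finite D" "\<And>F. F \<in> \<F> \<Longrightarrow> S \<subseteq> F \<Longrightarrow> F \<inter> D \<noteq> {}"
  shows "card {F \<in> \<F>. S \<subseteq> F} \<le> (\<Sum>d\<in>D. card {F \<in> \<F>. insert d S \<subseteq> F})"
proof -
  have "{F \<in> \<F>. S \<subseteq> F} \<subseteq> (\<Union>d\<in>D. {F \<in> \<F>. insert d S \<subseteq> F})" using assms(3) by fastforce
  then have "card {F \<in> \<F>. S \<subseteq> F} \<le> card (\<Union>d\<in>D. {F \<in> \<F>. insert d S \<subseteq> F})"
    using assms by (intro card_mono) auto
  also have "\<dots> \<le> (\<Sum>d\<in>D. card {F \<in> \<F>. insert d S \<subseteq> F})" by (rule card_UN_le) fact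
  finally show ?thesis .
qed

lemma card_superset_le:
  assumes "finite V" "\<F> \<subseteq> [V]\<^bsup>p\<^esup>" "S \<subseteq> V" "p \<le> card V"
  shows "card {F \<in> \<F>. S \<subseteq> F} \<le> (card V - card S) choose (card V - p)"
proof -
  have "card {F \<in> \<F>. S \<subseteq> F} \<le> card (star V p S)"
    using assms by (intro card_mono finite_star) (auto simp: star_def)
  then show ?thesis using card_star assms by metis
qed

text \<open>A member \<open>G\<close> of \<H> witnesses that \<open>S\<close> is not a cover. Every
  member of \<F> contains one of the \<open>q - t + 1\<close> branching elements chosen in
  \<open>G - S\<close>, and each branch contributes at most \<open>B\<close>.\<close>

lemma card_superset_le_step:
  assumes V: "finite V" "\<F> \<subseteq> [V]\<^bsup>p\<^esup>" "\<H> \<subseteq> [V]\<^bsup>q\<^esup>" "t \<le> q"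
    and cross: "cross_intersecting t \<F> \<H>"
    and S: "\<not> t_cover t \<H> S"
    and B: "\<And>d. d \<in> V - S \<Longrightarrow> card {F \<in> \<F>. insert d S \<subseteq> F} \<le> B"
  shows "card {F \<in> \<F>. S \<subseteq> F} \<le> (q - t + 1) * B"
proof -
  obtain G where G: "G \<in> \<H>" "card (S \<inter> G) < t" using S by (auto simp: t_cover_def not_le)
  then have GV: "G \<in> [V]\<^bsup>q\<^esup>" using V by auto
  obtain D where D: "D \<subseteq> G - S" "card D = q - t + 1" "finite D"
    "\<And>F. t \<le> card (F \<inter> G) \<Longrightarrow> F \<inter> D \<noteq> {}"
    using branching[OF GV G(2) V(4)] by blast
  have DV: "D \<subseteq> V - S" using D GV by (auto simp: nsets_def)
  have "card {F \<in> \<F>. S \<subseteq> F} \<le> (\<Sum>d\<in>D. card {F \<in> \<F>. insert d S \<subseteq> F})"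
  proof (rule card_le_branching)
    show "finite \<F>" using V(2) finite_imp_finite_nsets[OF V(1)] by (rule finite_subset)
    show "F \<inter> D \<noteq> {}" if "F \<in> \<F>" for F
      using cross that G D(4)[of F] by (auto simp: cross_intersecting_def)
  qed (rule D)
  also have "\<dots> \<le> (\<Sum>d\<in>D. B)" using DV B by (intro sum_mono) auto
  finally show ?thesis using D by simp
qed

text \<open>A set with fewer than \<open>m\<close> elements is not a cover, so the branching step
  can be repeated until size \<open>m\<close> is reached; here it is used \<open>j\<close>
  times.\<close>

lemma card_superset_le_iterated:
  assumes V: "finite V" "\<F> \<subseteq> [V]\<^bsup>p\<^esup>" "\<H> \<subseteq> [V]\<^bsup>q\<^esup>" "p \<le> card V" "t \<le> q"
    and cross: "cross_intersecting t \<F> \<H>"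
    and min: "\<And>T. T \<subseteq> V \<Longrightarrow> t_cover t \<H> T \<Longrightarrow> m \<le> card T"
    and S: "S \<subseteq> V" "card S + j \<le> m"
  shows "card {F \<in> \<F>. S \<subseteq> F} \<le> (q - t + 1) ^ j * ((card V - (card S + j)) choose (card V - p))"
  using S
proof (induction j arbitrary: S)
  case 0
  then show ?case using card_superset_le[OF V(1,2)] V by simp
next
  case (Suc j)
  have fS: "finite S" using Suc.prems(1) V(1) by (rule finite_subset)
  have "card {F \<in> \<F>. insert d S \<subseteq> F} \<le> (q - t + 1) ^ j * ((card V - (card S + Suc j)) choose (card V - p))"
    if "d \<in> V - S" for d
    using Suc.IH[of "insert d S"] that fS Suc.prems by auto
  moreover have "\<not> t_cover t \<H> S" using min[of S] Suc.prems by auto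
  ultimately show ?case
    unfolding power_Suc mult.assoc by (intro card_superset_le_step[OF V(1-3,5) cross])
qed

text \<open>Every member of \<F> contains one of the \<open>t\<close>-subsets of the cover
  \<open>T\<close>, and from each of these \<open>i\<close> branching steps are possible because
  covers of \<H> have at least \<open>t + i\<close> elements.\<close>

lemma card_le_via_covers:
  assumes V: "finite V" "\<F> \<subseteq> [V]\<^bsup>p\<^esup>" "\<H> \<subseteq> [V]\<^bsup>q\<^esup>" "p \<le> card V" "t \<le> q"
    and cross: "cross_intersecting t \<F> \<H>"
    and min: "\<And>T. T \<subseteq> V \<Longrightarrow> t_cover t \<H> T \<Longrightarrow> t + i \<le> card T"
    and T: "T \<subseteq> V" "t_cover t \<F> T"
  shows "card \<F> \<le> (card T choose t) * ((q - t + 1) ^ i * ((card V - t - i) choose (card V - p)))"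
proof -
  have fT: "finite T" using T(1) V(1) by (rule finite_subset)
  have fF: "finite \<F>" using V(2) finite_imp_finite_nsets[OF V(1)] by (rule finite_subset)
  have "\<F> \<subseteq> (\<Union>S\<in>[T]\<^bsup>t\<^esup>. {F \<in> \<F>. S \<subseteq> F})"
  proof
    fix F assume F: "F \<in> \<F>"
    then have "t \<le> card (T \<inter> F)" using T by (auto simp: t_cover_def)
    then obtain S where "S \<subseteq> T \<inter> F" "card S = t" "finite S" using obtain_subset_with_card_n by metis
    then have "S \<in> [T]\<^bsup>t\<^esup>" "S \<subseteq> F" by (auto simp: nsets_def)
    then show "F \<in> (\<Union>S\<in>[T]\<^bsup>t\<^esup>. {F \<in> \<F>. S \<subseteq> F})" using F by auto
  qed
  then have "card \<F> \<le> card (\<Union>S\<in>[T]\<^bsup>t\<^esup>. {F \<in> \<F>. S \<subseteq> F})"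
    using fF fT by (intro card_mono) (auto simp: finite_imp_finite_nsets)
  also have "\<dots> \<le> (\<Sum>S\<in>[T]\<^bsup>t\<^esup>. card {F \<in> \<F>. S \<subseteq> F})"
    using fT by (intro card_UN_le finite_imp_finite_nsets)
  also have "\<dots> \<le> (\<Sum>S\<in>[T]\<^bsup>t\<^esup>. (q - t + 1) ^ i * ((card V - t - i) choose (card V - p)))"
  proof (rule sum_mono)
    fix S assume "S \<in> [T]\<^bsup>t\<^esup>"
    then have "S \<subseteq> V" "card S = t" using T by (auto simp: nsets_def)
    then show "card {F \<in> \<F>. S \<subseteq> F} \<le> (q - t + 1) ^ i * ((card V - t - i) choose (card V - p))"
      using card_superset_le_iterated[OF V cross min, of S i] by simp
  qed
  finally show ?thesis by (simp add: card_nsets)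
qed

section \<open>Extremal configurations\<close>

text \<open>For \<open>F\<close> containing \<open>X\<close>, the condition on
  \<open>F \<inter> M\<close> fails exactly when \<open>F\<close> avoids \<open>M - X\<close>; such
  sets are subtracted.\<close>

lemma card_subfamily_meeting:
  assumes "finite V" "M \<subseteq> V" "X \<subseteq> M" "card X \<le> p"
  shows "card {F \<in> [V]\<^bsup>p\<^esup>. X \<subseteq> F \<and> card X + 1 \<le> card (F \<inter> M)} =
    ((card V - card X) choose (p - card X)) - ((card V - card M) choose (p - card X))"
proof -
  have fin: "finite M" "finite X" using assms(1-3) by (auto intro: finite_subset)
  let ?A = "{F \<in> [V]\<^bsup>p\<^esup>. X \<subseteq> F}" and ?B = "{F \<in> [V]\<^bsup>p\<^esup>. X \<subseteq> F \<and> F \<inter> (M - X) = {}}"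
  have *: "card X + 1 \<le> card (F \<inter> M) \<longleftrightarrow> F \<inter> (M - X) \<noteq> {}" if "X \<subseteq> F" for F
  proof -
    have "F \<inter> M = X \<union> (F \<inter> (M - X))" using that assms(3) by blast
    then have "card (F \<inter> M) = card X + card (F \<inter> (M - X))"
      using fin by (subst card_Un_disjoint[symmetric]) auto
    moreover have "card (F \<inter> (M - X)) = 0 \<longleftrightarrow> F \<inter> (M - X) = {}" using fin by simp
    ultimately show ?thesis by linarith
  qed
  have "{F \<in> [V]\<^bsup>p\<^esup>. X \<subseteq> F \<and> card X + 1 \<le> card (F \<inter> M)} = ?A - ?B"
    using * by blast
  moreover have "card (?A - ?B) = card ?A - card ?B"
  proof (rule card_Diff_subset)
    show "finite ?B" using assms(1) by (simp add: finite_imp_finite_nsets)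
    show "?B \<subseteq> ?A" by blast
  qed
  moreover have XV: "X \<subseteq> V" using assms(2,3) by blast
  then have "card ?A = (card V - card X) choose (p - card X)"
    by (rule card_superset[OF assms(1) _ assms(4)])
  moreover have "card ?B = (card V - card X - card (M - X)) choose (p - card X)"
    using assms(2,3) by (intro card_superset_disjoint assms(1,4) XV) auto
  moreover have "card V - card X - card (M - X) = card V - card M"
    using fin assms(3) card_mono[of M X] by (simp add: card_Diff_subset)
  ultimately show ?thesis by presburger
qed

text \<open>A \<open>q\<close>-subset of the \<open>(q + 1)\<close>-set \<open>M\<close> that does
  not contain \<open>X\<close> is \<open>M - {x}\<close> for some \<open>x\<close> in
  \<open>X\<close>, so at most \<open>card X\<close> sets are added to the star.\<close>

lemma card_star_Un_nsets_le:
  assumes "finite V" "M \<subseteq> V" "X \<subseteq> M" "card M = q + 1" "card X \<le> q"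
  shows "card (star V q X \<union> [M]\<^bsup>q\<^esup>) \<le> ((card V - card X) choose (q - card X)) + card X"
proof -
  have fin: "finite M" "finite X" using assms(1-3) by (auto intro: finite_subset)
  have "star V q X \<union> [M]\<^bsup>q\<^esup> \<subseteq> {F \<in> [V]\<^bsup>q\<^esup>. X \<subseteq> F} \<union> (\<lambda>x. M - {x}) ` X"
  proof
    fix G assume G: "G \<in> star V q X \<union> [M]\<^bsup>q\<^esup>"
    show "G \<in> {F \<in> [V]\<^bsup>q\<^esup>. X \<subseteq> F} \<union> (\<lambda>x. M - {x}) ` X"
    proof (cases "X \<subseteq> G")
      case True
      then show ?thesis using G assms(2) by (auto simp: star_def nsets_def)
    next
      case False
      then obtain x where x: "x \<in> X" "x \<notin> G" by auto
      have GM: "G \<subseteq> M" "card G = q" using G False by (auto simp: star_def nsets_def)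
      have "G = M - {x}"
        using x GM fin assms(3,4) by (intro card_subset_eq) auto
      then show ?thesis using x by auto
    qed
  qed
  then have "card (star V q X \<union> [M]\<^bsup>q\<^esup>) \<le> card ({F \<in> [V]\<^bsup>q\<^esup>. X \<subseteq> F} \<union> (\<lambda>x. M - {x}) ` X)"
    using fin assms(1) by (intro card_mono) (simp_all add: finite_imp_finite_nsets)
  also have "\<dots> \<le> card {F \<in> [V]\<^bsup>q\<^esup>. X \<subseteq> F} + card ((\<lambda>x. M - {x}) ` X)"
    by (rule card_Un_le)
  also have "\<dots> \<le> ((card V - card X) choose (q - card X)) + card X"
    using card_superset[of V X q] assms card_image_le[OF fin(2), of "\<lambda>x. M - {x}"] by auto
  finally show ?thesis .
qed

text \<open>Such an \<open>F\<close> either contains \<open>T\<close> or misses exactly one of its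
  \<open>t + 1\<close> elements.\<close>

lemma card_almost_containing_le:
  assumes "finite V" "T \<subseteq> V" "card T = t + 1" "t + 1 \<le> q"
  shows "card {F \<in> [V]\<^bsup>q\<^esup>. t \<le> card (F \<inter> T)} \<le>
    (t + 1) * ((card V - t - 1) choose (q - t)) + ((card V - t - 1) choose (q - t - 1))"
proof -
  have fT: "finite T" using assms(3) card.infinite by fastforce
  let ?B = "\<lambda>x. {F \<in> [V]\<^bsup>q\<^esup>. T - {x} \<subseteq> F \<and> F \<inter> {x} = {}}"
  let ?A = "{F \<in> [V]\<^bsup>q\<^esup>. T \<subseteq> F}"
  have sub: "{F \<in> [V]\<^bsup>q\<^esup>. t \<le> card (F \<inter> T)} \<subseteq> (\<Union>x\<in>T. ?B x) \<union> ?A"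
  proof
    fix F assume F: "F \<in> {F \<in> [V]\<^bsup>q\<^esup>. t \<le> card (F \<inter> T)}"
    show "F \<in> (\<Union>x\<in>T. ?B x) \<union> ?A"
    proof (cases "T \<subseteq> F")
      case False
      then obtain x where x: "x \<in> T" "x \<notin> F" by auto
      have "F \<inter> T = T - {x}"
        using x F fT assms(3) by (intro card_seteq) auto
      then show ?thesis using x F by blast
    qed (use F in auto)
  qed
  have fin: "finite (?B x)" "finite ?A" for x
    using assms(1) by (simp_all add: finite_imp_finite_nsets)
  have B: "card (?B x) = (card V - t - 1) choose (q - t)" if "x \<in> T" for x
  proof -
    have c: "card (T - {x}) = t" using that fT assms(3) by simp
    have "card (?B x) = (card V - card (T - {x}) - card {x}) choose (q - card (T - {x}))"
    proof (rule card_superset_disjoint)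
      show "T - {x} \<subseteq> V" "{x} \<subseteq> V" using assms(2) that by auto
      show "card (T - {x}) \<le> q" using c assms(4) by simp
    qed (use assms(1) in auto)
    then show ?thesis by (simp add: c)
  qed
  have "card {F \<in> [V]\<^bsup>q\<^esup>. t \<le> card (F \<inter> T)} \<le> card ((\<Union>x\<in>T. ?B x) \<union> ?A)"
    using sub fin fT by (intro card_mono) auto
  also have "\<dots> \<le> card (\<Union>x\<in>T. ?B x) + card ?A" by (rule card_Un_le)
  also have "card (\<Union>x\<in>T. ?B x) \<le> (\<Sum>x\<in>T. card (?B x))" by (rule card_UN_le) (rule fT)
  also have "\<dots> = (t + 1) * ((card V - t - 1) choose (q - t))"
    using B assms(3) by simp
  also have "card ?A = (card V - card T) choose (q - card T)"
    using assms by (intro card_superset) auto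
  finally show ?thesis using assms(3) by simp
qed

section \<open>Pairs with a common set on one side\<close>

lemma cross_intersecting_sym: "cross_intersecting t \<F> \<H> \<Longrightarrow> cross_intersecting t \<H> \<F>"
  unfolding cross_intersecting_def by (metis Int_commute)

text \<open>Everything depends on the set \<open>A\<close> of those \<open>y\<close> for which
  \<open>insert y X\<close> is a cover of \<H>. \<open>?P1\<close> belongs to the largest possible
  \<open>A\<close>, \<open>?P3\<close> to empty \<open>A\<close>; in between, \<open>?P2\<close> or
  \<open>?P4\<close> holds according to whether a chosen element of \<open>A\<close> lies in all of
  \<F>. The sizes \<open>p\<close> and \<open>q\<close> are not ordered, so that either family can
  play the role of \<F>.\<close>

lemma one_sided_trichotomy:
  assumes V: "finite V" "\<F> \<subseteq> [V]\<^bsup>p\<^esup>" "\<H> \<subseteq> [V]\<^bsup>q\<^esup>" "p \<le> card V" "q \<le> card V"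
    and tpq: "t < p" "t < q"
    and cross: "cross_intersecting t \<F> \<H>"
    and X: "X \<subseteq> V" "card X = t" "\<forall>F\<in>\<F>. X \<subseteq> F"
    and minF: "\<forall>T\<subseteq>V. t_cover t \<F> T \<longrightarrow> t \<le> card T"
    and minH: "\<forall>T\<subseteq>V. t_cover t \<H> T \<longrightarrow> t + 1 \<le> card T"
    and T: "T \<subseteq> V" "t_cover t \<H> T" "card T = t + 1"
  shows "(\<exists>M. M \<subseteq> V \<and> card M = q + 1 \<and> X \<subseteq> M \<and>
            \<F> \<subseteq> {F \<in> [V]\<^bsup>p\<^esup>. X \<subseteq> F \<and> t + 1 \<le> card (F \<inter> M)} \<and> \<H> \<subseteq> star V q X \<union> [M]\<^bsup>q\<^esup>) \<or>
         (\<exists>Y. Y \<subseteq> V \<and> card Y = t + 1 \<and> \<F> \<subseteq> star V p Y \<and> \<H> \<subseteq> {F \<in> [V]\<^bsup>q\<^esup>. t \<le> card (F \<inter> Y)}) \<or>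
         (card \<F> \<le> (q - t + 1) * ((q - t + 1) * ((card V - t - 2) choose (card V - p))) \<and>
          card \<H> \<le> (t + 1) * ((card V - t) choose (card V - q))) \<or>
         (\<exists>a. 1 \<le> a \<and> a \<le> q - t \<and>
            card \<F> \<le> a * ((card V - t - 1) choose (card V - p)) +
               (q - t + 1 - a) * ((q - t + 1) * ((card V - t - 2) choose (card V - p))) \<and>
            card \<H> \<le> ((card V - t) choose (card V - q)) +
               t * ((p - t) * ((card V - t - 1) choose (card V - q))))"
    (is "?P1 \<or> ?P2 \<or> ?P3 \<or> ?P4")
proof -
  note X = X(1,2) bspec[OF X(3)] and minF = minF[rule_format] and minH = minH[rule_format]
  have finX: "finite X" using X(1) V(1) by (rule finite_subset)
  have finF: "finite \<F>" using V(2) finite_imp_finite_nsets[OF V(1)] by (rule finite_subset)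
  have FV: "F \<subseteq> V" "finite F" "card F = p" if "F \<in> \<F>" for F using that V(2) by (auto simp: nsets_def)
  have HV: "G \<subseteq> V" "finite G" "card G = q" if "G \<in> \<H>" for G using that V(3) by (auto simp: nsets_def)
  define A where "A = {y \<in> V - X. t_cover t \<H> (insert y X)}"
  have AV: "A \<subseteq> V - X" by (auto simp: A_def)
  then have finA: "finite A" using V(1) by (auto intro: finite_subset)
  \<comment> \<open>Since \<open>G\<close> misses part of \<open>X\<close>, it has at most
    \<open>t - 1\<close> elements of \<open>X\<close>. One further element \<open>y\<close> makes up
    for this only if it lies in \<open>G\<close> and exactly one element of \<open>X\<close> is
    missing.\<close>
  have key: "A \<subseteq> G" "A \<noteq> {} \<Longrightarrow> card (X \<inter> G) = t - 1"
    if G: "G \<in> \<H>" "\<not> X \<subseteq> G" for G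
  proof -
    have "card (X \<inter> G) < card X" using G finX by (intro psubset_card_mono) auto
    then have lt: "card (X \<inter> G) < t" using X by simp
    have *: "y \<in> G \<and> card (X \<inter> G) = t - 1" if "y \<in> A" for y
    proof -
      have c: "t \<le> card (insert y X \<inter> G)" using that G by (auto simp: A_def t_cover_def)
      show ?thesis
      proof (cases "y \<in> G")
        case True
        then have "card (insert y X \<inter> G) = Suc (card (X \<inter> G))"
          using that AV finX by (subst Int_insert_left_if1) auto
        then show ?thesis using c lt True by linarith
      next
        case False
        then show ?thesis using c lt by simp
      qed
    qed
    show "A \<subseteq> G" using * by blast
    show "card (X \<inter> G) = t - 1" if "A \<noteq> {}" using * that by blast
  qed
  have "\<not> t_cover t \<H> X" using minH[of X] X by auto
  then obtain G0 where G0: "G0 \<in> \<H>" "card (X \<inter> G0) < t" by (auto simp: t_cover_def not_le)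
  then have nG0: "\<not> X \<subseteq> G0" using X by (metis Int_absorb2 less_irrefl)
  have "G0 \<in> [V]\<^bsup>q\<^esup>" using G0 V(3) by auto
  then obtain D where D: "D \<subseteq> G0 - X" "card D = q - t + 1" "finite D"
    and meet: "\<And>F. t \<le> card (F \<inter> G0) \<Longrightarrow> F \<inter> D \<noteq> {}"
    using branching[OF _ G0(2)] tpq by (metis less_imp_le)
  have DV: "D \<subseteq> V - X" using D HV[OF G0(1)] by auto
  \<comment> \<open>If \<open>A\<close> is nonempty, \<open>G0\<close> has exactly
    \<open>t - 1\<close> elements of \<open>X\<close>, so \<open>G0 - X\<close> has
    \<open>q - t + 1\<close> elements and \<open>D\<close> is all of it.\<close>
  have AD: "A \<subseteq> D"
  proof (cases "A = {}")
    case False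
    have "card (G0 - X) = q - card (X \<inter> G0)"
      using HV[OF G0(1)] finX by (metis card_Diff_subset_Int finite_Int inf_commute)
    also have "\<dots> = card D" using key(2)[OF G0(1) nG0 False] D G0(2) tpq by simp
    finally have "D = G0 - X" using D HV[OF G0(1)] by (intro card_subset_eq) auto
    then show ?thesis using key(1)[OF G0(1) nG0] AV by auto
  qed simp
  have meetF: "F \<inter> D \<noteq> {}" if "F \<in> \<F>" for F
    using meet cross G0 that by (auto simp: cross_intersecting_def)
  let ?a = "card A"
  let ?c1 = "(card V - t - 1) choose (card V - p)" and ?c2 = "(card V - t - 2) choose (card V - p)"
  have a_le: "?a \<le> q - t + 1" using card_mono[OF D(3) AD] D by simp
  \<comment> \<open>Branches at \<open>d\<close> in \<open>A\<close> are counted by stars of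
    \<open>(t + 1)\<close>-sets. For \<open>d\<close> outside \<open>A\<close> the set
    \<open>insert d X\<close> is not a cover, which allows a second branching step.\<close>
  have cardF: "card \<F> \<le> ?a * ?c1 + (q - t + 1 - ?a) * ((q - t + 1) * ?c2)"
  proof -
    have "{F \<in> \<F>. X \<subseteq> F} = \<F>" using X by auto
    then have "card \<F> \<le> (\<Sum>d\<in>D. card {F \<in> \<F>. insert d X \<subseteq> F})"
      using card_le_branching[OF finF D(3), of X] meetF by metis
    also have "\<dots> = (\<Sum>d\<in>A. card {F \<in> \<F>. insert d X \<subseteq> F}) + (\<Sum>d\<in>D - A. card {F \<in> \<F>. insert d X \<subseteq> F})"
      using sum.subset_diff[OF AD D(3)] by (simp add: add.commute)
    also have "(\<Sum>d\<in>A. card {F \<in> \<F>. insert d X \<subseteq> F}) \<le> (\<Sum>d\<in>A. ?c1)"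
    proof (rule sum_mono)
      fix d assume "d \<in> A"
      then have "insert d X \<subseteq> V" "card (insert d X) = t + 1" using AV X finX by auto
      then show "card {F \<in> \<F>. insert d X \<subseteq> F} \<le> ?c1"
        using card_superset_le[OF V(1,2) _ V(4)] by (metis diff_diff_left)
    qed
    also have "(\<Sum>d\<in>D - A. card {F \<in> \<F>. insert d X \<subseteq> F}) \<le> (\<Sum>d\<in>D - A. (q - t + 1) * ?c2)"
    proof (rule sum_mono)
      fix d assume d: "d \<in> D - A"
      then have dV: "insert d X \<subseteq> V" "d \<notin> X" and nc: "\<not> t_cover t \<H> (insert d X)"
        using DV X by (auto simp: A_def)
      show "card {F \<in> \<F>. insert d X \<subseteq> F} \<le> (q - t + 1) * ?c2"
      proof (rule card_superset_le_step[OF V(1-3) _ cross nc])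
        fix e assume "e \<in> V - insert d X"
        then have "insert e (insert d X) \<subseteq> V" "card (insert e (insert d X)) = t + 2"
          using dV X finX by auto
        then show "card {F \<in> \<F>. insert e (insert d X) \<subseteq> F} \<le> ?c2"
          using card_superset_le[OF V(1,2) _ V(4)] by (metis diff_diff_left)
      qed (use tpq in simp)
    qed
    also have "(\<Sum>d\<in>D - A. (q - t + 1) * ?c2) = (q - t + 1 - ?a) * ((q - t + 1) * ?c2)"
      using D AD finA by (simp add: card_Diff_subset)
    finally show ?thesis by simp
  qed
  consider "?a = q - t + 1" | "?a = 0" | "1 \<le> ?a" "?a \<le> q - t" using a_le by linarith
  then show ?thesis
  proof cases
    case 1
    then have "A = D" using AD D by (intro card_subset_eq) auto
    let ?M = "X \<union> A"
    have cM: "card ?M = q + 1" using 1 X AV finX finA tpq by (subst card_Un_disjoint) auto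
    have "\<F> \<subseteq> {F \<in> [V]\<^bsup>p\<^esup>. X \<subseteq> F \<and> t + 1 \<le> card (F \<inter> ?M)}"
    proof
      fix F assume F: "F \<in> \<F>"
      then obtain d where d: "d \<in> F" "d \<in> A" using meetF \<open>A = D\<close> by blast
      have "card (insert d X) \<le> card (F \<inter> ?M)"
        using d X F finX finA by (intro card_mono) auto
      moreover have "card (insert d X) = t + 1" using d AV X finX by auto
      ultimately show "F \<in> {F \<in> [V]\<^bsup>p\<^esup>. X \<subseteq> F \<and> t + 1 \<le> card (F \<inter> ?M)}"
        using F X V(2) by auto
    qed
    moreover have "\<H> \<subseteq> star V q X \<union> [?M]\<^bsup>q\<^esup>"
    proof
      fix G assume G: "G \<in> \<H>"
      show "G \<in> star V q X \<union> [?M]\<^bsup>q\<^esup>"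
      proof (cases "X \<subseteq> G")
        case True
        then show ?thesis using G V(3) by (auto simp: star_def)
      next
        case False
        have "A \<noteq> {}" using 1 by auto
        then have k: "A \<subseteq> G" "card (X \<inter> G) = t - 1" using key[OF G False] by auto
        have t: "0 < t" using False X finX by (metis card_0_eq empty_subsetI gr0I)
        \<comment> \<open>The \<open>t - 1\<close> elements of \<open>X\<close> and the
          \<open>q - t + 1\<close> elements of \<open>A\<close> exhaust \<open>G\<close>.\<close>
        have "card ((X \<inter> G) \<union> A) = card G"
          using k 1 HV[OF G] finX finA AV t tpq by (subst card_Un_disjoint) auto
        then have "(X \<inter> G) \<union> A = G" using k HV[OF G] by (intro card_subset_eq) auto
        then have "G \<subseteq> ?M" by blast
        then show ?thesis using HV[OF G] by (auto simp: nsets_def)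
      qed
    qed
    ultimately have ?P1 using cM X AV by (intro exI[of _ ?M]) auto
    then show ?thesis by blast
  next
    case 2
    \<comment> \<open>No branching is used here: the factor \<open>t + 1\<close> is the number of
      \<open>t\<close>-subsets of the cover \<open>T\<close>.\<close>
    have "card \<H> \<le> (card T choose t) * ((p - t + 1) ^ 0 * ((card V - t - 0) choose (card V - q)))"
      using card_le_via_covers[OF V(1,3,2,5) _ cross_intersecting_sym[OF cross] _ T(1,2), of 0] minF tpq
      by simp
    then have ?P3 using cardF 2 T(3) by simp
    then show ?thesis by blast
  next
    case 3
    then obtain y where y: "y \<in> A" by fastforce
    show ?thesis
    proof (cases "\<forall>F\<in>\<F>. y \<in> F")
      case True
      let ?Y = "insert y X"
      have "?Y \<subseteq> V" "card ?Y = t + 1" using y AV X finX by auto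
      moreover have "\<F> \<subseteq> star V p ?Y" using True X V(2) by (auto simp: star_def)
      moreover have "\<H> \<subseteq> {F \<in> [V]\<^bsup>q\<^esup>. t \<le> card (F \<inter> ?Y)}"
        using y V(3) by (auto simp: A_def t_cover_def Int_commute)
      ultimately have ?P2 by blast
      then show ?thesis by blast
    next
      case False
      then obtain F' where F': "F' \<in> \<F>" "y \<notin> F'" by auto
      have finF': "finite (F' - X)" and cF': "card (F' - X) = p - t"
        using FV[OF F'(1)] X(2) X(3)[OF F'(1)] finX by (auto simp: card_Diff_subset)
      \<comment> \<open>A member \<open>G\<close> of \<H> without \<open>X\<close> omits one
        \<open>x\<close> of \<open>X\<close> and contains \<open>y\<close>. It has only
        \<open>t - 1\<close> elements of \<open>X\<close> but meets \<open>F'\<close> in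
        \<open>t\<close> elements, so it also contains some \<open>z\<close> in
        \<open>F' - X\<close>. As \<open>F'\<close> avoids \<open>y\<close>, \<open>z\<close>
        differs from \<open>y\<close>, and \<open>G\<close> contains a set of \<open>t + 1\<close>
        elements.\<close>
      let ?B = "\<lambda>x z. star V q (insert y (insert z (X - {x})))"
      have sub: "\<H> \<subseteq> star V q X \<union> (\<Union>x\<in>X. \<Union>z\<in>F' - X. ?B x z)"
      proof
        fix G assume G: "G \<in> \<H>"
        show "G \<in> star V q X \<union> (\<Union>x\<in>X. \<Union>z\<in>F' - X. ?B x z)"
        proof (cases "X \<subseteq> G")
          case True
          then show ?thesis using G V(3) by (auto simp: star_def)
        next
          case False
          then have k: "y \<in> G" "card (X \<inter> G) = t - 1" using key[OF G] y by auto
          obtain x where x: "x \<in> X" "x \<notin> G" using False by auto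
          then have t: "0 < t" using X finX by (metis card_gt_0_iff empty_iff)
          have XG: "X - {x} = X \<inter> G"
            using x k X finX by (intro card_seteq[symmetric]) auto
          have "\<not> F' \<inter> G \<subseteq> X"
          proof
            assume "F' \<inter> G \<subseteq> X"
            then have "card (F' \<inter> G) \<le> card (X \<inter> G)" using finX by (intro card_mono) auto
            moreover have "t \<le> card (F' \<inter> G)" using cross F' G by (auto simp: cross_intersecting_def)
            ultimately show False using k t by linarith
          qed
          then obtain z where z: "z \<in> F' - X" "z \<in> G" by auto
          have "insert y (insert z (X - {x})) \<subseteq> G" using XG z k by auto
          then have "G \<in> ?B x z" using G V(3) by (auto simp: star_def)
          then show ?thesis using x z by blast
        qed
      qed
      have cB: "card (?B x z) = (card V - t - 1) choose (card V - q)" if "x \<in> X" "z \<in> F' - X" for x z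
      proof -
        have 1: "insert y (insert z (X - {x})) \<subseteq> V" using that y AV X FV[OF F'(1)] by auto
        have "z \<noteq> y" using that F' by auto
        then have "card (insert y (insert z (X - {x}))) = Suc (Suc (card (X - {x})))"
          using that y AV finX by (subst card_insert_disjoint; force)
        also have "\<dots> = t + 1" using that X finX by (metis Suc_eq_plus1 card_Suc_Diff1)
        finally show ?thesis using card_star[OF V(1) 1 V(5)] by simp
      qed
      have "card \<H> \<le> card (star V q X \<union> (\<Union>x\<in>X. \<Union>z\<in>F' - X. ?B x z))"
        using sub finX finF' finite_star[OF V(1)] by (intro card_mono) auto
      also have "\<dots> \<le> card (star V q X) + card (\<Union>x\<in>X. \<Union>z\<in>F' - X. ?B x z)"
        by (rule card_Un_le)
      also have "card (\<Union>x\<in>X. \<Union>z\<in>F' - X. ?B x z) \<le> (\<Sum>x\<in>X. card (\<Union>z\<in>F' - X. ?B x z))"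
        by (rule card_UN_le) (rule finX)
      also have "\<dots> \<le> (\<Sum>x\<in>X. \<Sum>z\<in>F' - X. card (?B x z))"
        by (intro sum_mono card_UN_le finF')
      also have "\<dots> = (\<Sum>x\<in>X. \<Sum>z\<in>F' - X. (card V - t - 1) choose (card V - q))"
        by (intro sum.cong refl cB)
      also have "\<dots> = t * ((p - t) * ((card V - t - 1) choose (card V - q)))"
        using X cF' by simp
      also have "card (star V q X) = (card V - t) choose (card V - q)"
        using card_star[OF V(1) X(1) V(5)] X(2) by simp
      finally have "card \<H> \<le> ((card V - t) choose (card V - q)) + t * ((p - t) * ((card V - t - 1) choose (card V - q)))"
        by simp
      then have ?P4 using cardF 3 by blast
      then show ?thesis by blast
    qed
  qed
qed

section \<open>Estimates over the reals\<close>

lemma mult_divide_le_divide: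
  fixes c D d m :: real
  assumes "0 < m" "0 < d" "0 \<le> c" "D * m \<le> d"
  shows "c * D / d \<le> c / m"
proof -
  have "c * (D * m) \<le> c * d" using assms by (intro mult_left_mono)
  then show ?thesis using assms(1,2) by (simp add: field_simps)
qed

text \<open>In the locale, \<open>N = n - t\<close>, \<open>l = k\<^sub>1 - t\<close>, \<open>k = k\<^sub>2 - t\<close>. Products of two sizes are measured in units
  of \<open>C(N, l) C(N, k) / N\<close>; in these units, \<open>l * (M - 1 / (2 * (t + 1)))\<close> lies below the
  claimed bound and above every product outside the extremal configurations.\<close>

locale size_estimates =
  fixes N l k t m M :: real
  assumes t1: "1 \<le> t" and k1: "1 \<le> k" and kl: "k \<le> l"
    and mM: "k \<le> t \<and> m = t + 1 \<and> M = t + 1 \<or> t + 1 \<le> k \<and> m = k \<and> M = k + 1"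
    and N: "m * (t + 1) * (l + 1) * (k + 1) \<le> N - 1"
begin

text \<open>In these units the leading term of the claimed bound is \<open>l * (k + 1)\<close> if
  \<open>t + 1 \<le> k\<close> and \<open>l * (t + 1)\<close> if \<open>k \<le> t\<close>, that is,
  \<open>l * M\<close> in both cases. The subtracted fraction leaves room for the second-order
  terms.\<close>

definition U :: real where "U = l * (M - 1 / (2 * (t + 1)))"

lemma U_eq: "U = l * M - l / (2 * (t + 1))"
  by (simp add: U_def right_diff_distrib)

lemma l1: "1 \<le> l" and m2: "2 \<le> m" and M2: "2 \<le> M"
  using t1 k1 kl mM by auto

lemma N_pos: "0 < N - 1" "0 < N"
proof -
  have "0 < m * (t + 1) * (l + 1) * (k + 1)" using t1 k1 l1 m2 by simp
  then show "0 < N - 1" "0 < N" using N by linarith+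
qed

text \<open>This is the form in which the lower bound on \<open>N\<close> enters the estimates: the
  product of the three sums, divided by \<open>N\<close> or \<open>N - 1\<close>, is at most
  \<open>1 / m\<close>.\<close>

lemma divide_N_le_divide_m:
  assumes "0 \<le> c"
  shows "c * ((t + 1) * (l + 1) * (k + 1)) / (N - 1) \<le> c / m"
    and "c * ((t + 1) * (l + 1) * (k + 1)) / N \<le> c / m"
  using m2 N_pos assms N by (auto intro!: mult_divide_le_divide simp: mult_ac)

lemma half_inverse_le: "1 / (2 * (t + 1)) \<le> 1 / 4"
  using t1 by (simp add: field_simps)

section \<open>Products outside the extremal configurations stay below the threshold\<close>

lemma estimate_1_1: "(t + 1)\<^sup>2 * (k + 1) * (l + 1) * l * k / N < U"
proof -
  have "(t + 1)\<^sup>2 * (k + 1) * (l + 1) * l * k / N = ((t + 1) * l * k) * ((t + 1) * (l + 1) * (k + 1)) / N"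
    by (simp add: power2_eq_square mult_ac)
  also have "\<dots> \<le> ((t + 1) * l * k) / m" using t1 l1 k1 by (intro divide_N_le_divide_m) auto
  also have "\<dots> \<le> l * (M - 1)"
  proof -
    \<comment> \<open>Equality occurs for \<open>k = t\<close> and for \<open>k = t + 1\<close>;
      strictness is gained afterwards, from the difference between \<open>M - 1\<close> and
      \<open>M - 1 / (2 * (t + 1))\<close>.\<close>
    have "(t + 1) * k \<le> (M - 1) * m" using mM t1 k1
      by (auto simp: mult.commute intro: mult_left_mono mult_right_mono)
    then have "l * ((t + 1) * k) \<le> l * ((M - 1) * m)" using l1 by (intro mult_left_mono) auto
    then show ?thesis using m2 by (simp add: field_simps)
  qed
  also have "\<dots> < U" unfolding U_def using l1 half_inverse_le by (intro mult_strict_left_mono) linarith+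
  finally show ?thesis .
qed

text \<open>The left side is what remains of the estimates for two branching steps on one side,
  after the lower bound on \<open>N\<close> is inserted and \<open>l\<close> is divided out.\<close>

lemma two_step_factor_less: "(t + 2) * (k + 1) / (2 * m) < M - 1 / (2 * (t + 1))"
proof -
  have "(t + 2) * (k + 1) < (M - 1 / 4) * (2 * m)"
    using mM
  proof
    assume *: "k \<le> t \<and> m = t + 1 \<and> M = t + 1"
    then have "(t + 2) * (k + 1) \<le> (t + 2) * (t + 1)" using t1 by (intro mult_left_mono) auto
    also have "\<dots> < (2 * t + 3 / 2) * (t + 1)" using t1 by (intro mult_strict_right_mono) auto
    also have "\<dots> = (M - 1 / 4) * (2 * m)" using * by (simp add: field_simps)
    finally show ?thesis .
  next
    assume *: "t + 1 \<le> k \<and> m = k \<and> M = k + 1"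
    then have "(t + 2) * (k + 1) \<le> (k + 1) * (k + 1)" using k1 by (intro mult_right_mono) auto
    also have "\<dots> < (M - 1 / 4) * (2 * m)"
    proof -
      have "2 * k \<le> k * k" using * t1 by (intro mult_right_mono) auto
      moreover have "(M - 1 / 4) * (2 * m) = 2 * (k * k) + 3 / 2 * k" using * by (simp add: field_simps)
      moreover have "(k + 1) * (k + 1) = k * k + 2 * k + 1" by (simp add: algebra_simps)
      ultimately show ?thesis using * t1 by linarith
    qed
    finally show ?thesis .
  qed
  then have "(t + 2) * (k + 1) / (2 * m) < M - 1 / 4" using m2 by (simp add: field_simps)
  then show ?thesis using half_inverse_le by linarith
qed

lemma estimate_2_0: "(t + 2) * (t + 1) / 2 * (k + 1)\<^sup>2 * l * (l - 1) / (N - 1) < U"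
proof -
  \<comment> \<open>Raising \<open>l - 1\<close> to \<open>l + 1\<close> completes the factor
    \<open>(t + 1) * (l + 1) * (k + 1)\<close> that can be weighed against
    \<open>N - 1\<close>.\<close>
  have "(t + 2) * (t + 1) / 2 * (k + 1)\<^sup>2 * l * (l - 1) \<le> (t + 2) * (t + 1) / 2 * (k + 1)\<^sup>2 * l * (l + 1)"
    using t1 l1 by (intro mult_left_mono) auto
  also have "\<dots> = ((t + 2) / 2 * (k + 1) * l) * ((t + 1) * (l + 1) * (k + 1))"
    by (simp add: power2_eq_square mult_ac)
  finally have "(t + 2) * (t + 1) / 2 * (k + 1)\<^sup>2 * l * (l - 1) / (N - 1) \<le>
      ((t + 2) / 2 * (k + 1) * l) * ((t + 1) * (l + 1) * (k + 1)) / (N - 1)"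
    using N_pos by (intro divide_right_mono) auto
  also have "\<dots> \<le> ((t + 2) / 2 * (k + 1) * l) / m" using t1 l1 k1 by (intro divide_N_le_divide_m) auto
  also have "\<dots> = l * ((t + 2) * (k + 1) / (2 * m))" by simp
  also have "\<dots> < U" unfolding U_def using l1 two_step_factor_less by (intro mult_strict_left_mono) auto
  finally show ?thesis .
qed

lemma estimate_0_2: "(t + 2) * (t + 1) / 2 * (l + 1)\<^sup>2 * k * (k - 1) / (N - 1) < U"
proof -
  \<comment> \<open>This use of \<open>k \<le> l\<close> reduces the claim to the same upper bound
    as in \<open>estimate_2_0\<close>.\<close>
  have "(l + 1) * k \<le> l * (k + 1)" using kl by (simp add: algebra_simps)
  then have "(l + 1) * k * (k - 1) \<le> (l * (k + 1)) * (k + 1)" by (rule mult_mono) (use k1 l1 in auto)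
  then have "(t + 2) * (t + 1) / 2 * (l + 1) * ((l + 1) * k * (k - 1)) \<le>
      (t + 2) * (t + 1) / 2 * (l + 1) * ((l * (k + 1)) * (k + 1))"
    using t1 l1 by (intro mult_left_mono) auto
  then have "(t + 2) * (t + 1) / 2 * (l + 1)\<^sup>2 * k * (k - 1) \<le>
      ((t + 2) / 2 * (k + 1) * l) * ((t + 1) * (l + 1) * (k + 1))"
    by (simp add: power2_eq_square mult_ac)
  then have "(t + 2) * (t + 1) / 2 * (l + 1)\<^sup>2 * k * (k - 1) / (N - 1) \<le>
      ((t + 2) / 2 * (k + 1) * l) * ((t + 1) * (l + 1) * (k + 1)) / (N - 1)"
    using N_pos by (intro divide_right_mono) auto
  also have "\<dots> \<le> ((t + 2) / 2 * (k + 1) * l) / m" using t1 l1 k1 by (intro divide_N_le_divide_m) auto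
  also have "\<dots> = l * ((t + 2) * (k + 1) / (2 * m))" by simp
  also have "\<dots> < U" unfolding U_def using l1 two_step_factor_less by (intro mult_strict_left_mono) auto
  finally show ?thesis .
qed

lemma mid_factor_less: "(k + 1 / (m * (t + 1))) * (1 + t * k / ((t + 1) * (k + 1) * m)) < M - 1 / (2 * (t + 1))"
  using mM
proof
  assume *: "k \<le> t \<and> m = t + 1 \<and> M = t + 1"
  define s where "s = t + 1"
  have s: "2 \<le> s" "k \<le> s - 1" "t = s - 1" "m = s" "M = s" using * t1 by (auto simp: s_def)
  \<comment> \<open>In the second factor \<open>k / (k + 1)\<close> is replaced by 1; in the first
    one \<open>k\<close> is replaced by \<open>t = s - 1\<close>.\<close>
  have "(s - 1) * k * (s * s) \<le> (s - 1) * (k + 1) * (s * s)"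
    using s by (intro mult_right_mono mult_left_mono) auto
  then have "(s - 1) * k / (s * (k + 1) * s) \<le> (s - 1) / s\<^sup>2"
    using s k1 by (simp add: divide_simps power2_eq_square mult_ac)
  moreover have "k + 1 / (s * s) \<le> s - 1 + 1 / s\<^sup>2" using s by (simp add: power2_eq_square)
  ultimately have "(k + 1 / (s * s)) * (1 + (s - 1) * k / (s * (k + 1) * s)) \<le> (s - 1 + 1 / s\<^sup>2) * (1 + (s - 1) / s\<^sup>2)"
    using s k1 by (intro mult_mono) auto
  also have "\<dots> < s - 1 / (2 * s)"
  proof -
    have "2 * (s * s) \<le> s * (s * s)" using s by (intro mult_right_mono) auto
    moreover have "2 * s \<le> s * s" using s by (intro mult_right_mono) auto
    \<comment> \<open>This polynomial is the difference of the two sides multiplied by the fourth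
      power of \<open>s\<close>.\<close>
    ultimately have "0 < 3 / 2 * (s * (s * s)) - 2 * (s * s) - s + 1" using s by linarith
    then have "0 < (3 / 2 * (s * (s * s)) - 2 * (s * s) - s + 1) / (s * (s * (s * s)))"
      using s by (intro divide_pos_pos) auto
    also have "\<dots> = s - 1 / (2 * s) - (s - 1 + 1 / s\<^sup>2) * (1 + (s - 1) / s\<^sup>2)"
      using s by (simp add: field_simps power2_eq_square)
    finally show ?thesis by simp
  qed
  finally show ?thesis using s by simp
next
  assume *: "t + 1 \<le> k \<and> m = k \<and> M = k + 1"
  define s where "s = t + 1"
  have s: "2 \<le> s" "s \<le> k" "t = s - 1" "m = k" "M = k + 1" using * t1 by (auto simp: s_def)
  define a where "a = (s - 1) / (k + 1)"
  have a: "0 \<le> a" using s by (simp add: a_def)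
  \<comment> \<open>With \<open>k + 1 = (k) + 1\<close> in the denominator of \<open>a\<close>, the
    product \<open>a * k\<close> is \<open>t - a\<close>; the resulting term \<open>- k * a\<close>
    absorbs \<open>a / s\<close> because \<open>k \<ge> 2\<close>.\<close>
  have ak: "a * k = (s - 1) - a" using s by (simp add: a_def field_simps)
  have "k * s * ((k + 1 / (k * s)) * (1 + a / s)) = k * (k * s) + 1 + k * (a * k) + a / s"
    using s by (simp add: field_simps)
  also have "\<dots> = k * (k * s) + 1 + k * (s - 1) - k * a + a / s" by (simp add: ak algebra_simps)
  also have "\<dots> < k * (k * s) + k * s - k / 2"
  proof -
    have "a / s \<le> a" using s a by (simp add: divide_le_eq mult_le_cancel_left1)
    moreover have "2 * a \<le> k * a" using s a by (intro mult_right_mono) auto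
    moreover have "0 < a" using s by (simp add: a_def)
    moreover have "k * (s - 1) = k * s - k" by (simp add: algebra_simps)
    ultimately show ?thesis using s by linarith
  qed
  also have "\<dots> = k * s * (k + 1 - 1 / (2 * s))" using s by (simp add: field_simps)
  finally have "(k + 1 / (k * s)) * (1 + a / s) < k + 1 - 1 / (2 * s)"
    using s by (subst (asm) mult_less_cancel_left_pos) auto
  moreover have "t * k / ((t + 1) * (k + 1) * m) = a / s" using s by (simp add: a_def)
  ultimately show ?thesis using s by (simp add: mult_ac)
qed

text \<open>Here \<open>x\<close> and \<open>y\<close> are the normalised sizes when
  \<open>A\<close> is nonempty but not of largest size. They are constrained by inequalities so that
  both orders of the two families are served.\<close>

lemma estimate_mid:
  assumes "x \<le> k + (k + 1) * (l - 1) / (N - 1)" "0 \<le> y" "y \<le> 1 + t * l * k / N"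
  shows "l * x * y < U"
proof -
  have "(k + 1) * (l - 1) / (N - 1) \<le> 1 / (t + 1) * ((t + 1) * (l + 1) * (k + 1)) / (N - 1)"
  proof -
    have "1 / (t + 1) * ((t + 1) * (l + 1) * (k + 1)) = (k + 1) * (l + 1)" using t1 by (simp add: field_simps)
    moreover have "(k + 1) * (l - 1) \<le> (k + 1) * (l + 1)" using k1 by (intro mult_left_mono) auto
    ultimately show ?thesis using N_pos by (intro divide_right_mono) auto
  qed
  also have "\<dots> \<le> 1 / (t + 1) / m" using t1 by (intro divide_N_le_divide_m) auto
  finally have x: "x \<le> k + 1 / (m * (t + 1))" using assms(1) by (simp add: mult_ac)
  have "t * l * k \<le> t * k / ((t + 1) * (k + 1)) * ((t + 1) * (l + 1) * (k + 1))"
  proof -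
    have "t * k / ((t + 1) * (k + 1)) * ((t + 1) * (l + 1) * (k + 1)) = t * k * (l + 1)"
      using t1 k1 by simp
    also have "t * l * k \<le> \<dots>" using t1 k1 by (simp add: algebra_simps)
    finally show ?thesis .
  qed
  then have "t * l * k / N \<le> t * k / ((t + 1) * (k + 1)) * ((t + 1) * (l + 1) * (k + 1)) / N"
    using N_pos by (intro divide_right_mono) auto
  also have "\<dots> \<le> t * k / ((t + 1) * (k + 1)) / m" using t1 k1 by (intro divide_N_le_divide_m) auto
  finally have y: "y \<le> 1 + t * k / ((t + 1) * (k + 1) * m)" using assms(3) by simp
  have "x * y \<le> (k + 1 / (m * (t + 1))) * (1 + t * k / ((t + 1) * (k + 1) * m))"
    using x y assms(2) t1 k1 m2 by (intro mult_mono) auto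
  then have "x * y < M - 1 / (2 * (t + 1))" using mid_factor_less by linarith
  then have "l * (x * y) < U" unfolding U_def using l1 by (intro mult_strict_left_mono) auto
  then show ?thesis by (simp add: mult.assoc)
qed

section \<open>The threshold lies below the claimed bounds\<close>

lemma target_i:
  assumes "t + 1 \<le> k"
  shows "U \<le> l * (k + 1 - (k + 1) * k * (l - 1) / (2 * (N - 1)))"
proof -
  have M: "m = k" "M = k + 1" using mM assms by auto
  \<comment> \<open>The second-order term turns out to cost at most
    \<open>1 / (2 * (t + 1))\<close>, the amount by which \<open>U\<close> was lowered.\<close>
  have "(k + 1) * k * (l - 1) / 2 \<le> (k + 1) * k * (l + 1) / 2"
    using k1 by (intro divide_right_mono mult_left_mono) auto
  also have "\<dots> = k / (2 * (t + 1)) * ((t + 1) * (l + 1) * (k + 1))"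
    using t1 by (simp add: field_simps)
  finally have "(k + 1) * k * (l - 1) / 2 / (N - 1) \<le> k / (2 * (t + 1)) * ((t + 1) * (l + 1) * (k + 1)) / (N - 1)"
    using N_pos by (intro divide_right_mono) auto
  also have "\<dots> \<le> k / (2 * (t + 1)) / m" using t1 k1 by (intro divide_N_le_divide_m) auto
  also have "\<dots> = 1 / (2 * (t + 1))" using M k1 by simp
  finally show ?thesis unfolding U_def unfolding M(2) using l1 by (intro mult_left_mono) auto
qed

text \<open>The right-hand side is exactly \<open>bound_ii\<close> in the units used here; its
  second-order term again costs at most \<open>1 / (2 * (t + 1))\<close>.\<close>

lemma target_ii:
  assumes "k \<le> t"
  shows "U \<le> l * (t + 1 - t * k / N)"
proof -
  have M: "m = t + 1" "M = t + 1" using mM assms by auto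
  have "t * k \<le> (t + 1) / (2 * (t + 1)) * ((t + 1) * (l + 1) * (k + 1))"
  proof -
    have "t * k * 2 \<le> (t + 1) * (k + 1) * (l + 1)" using t1 k1 l1 by (intro mult_mono) auto
    moreover have "(t + 1) / (2 * (t + 1)) = 1 / 2" using t1 by simp
    ultimately show ?thesis by (simp only:) (simp add: mult_ac)
  qed
  then have "t * k / N \<le> (t + 1) / (2 * (t + 1)) * ((t + 1) * (l + 1) * (k + 1)) / N"
    using N_pos by (intro divide_right_mono) auto
  also have "\<dots> \<le> (t + 1) / (2 * (t + 1)) / m" using t1 by (intro divide_N_le_divide_m) auto
  also have "\<dots> = 1 / (2 * (t + 1))" using M t1 by simp
  finally show ?thesis unfolding U_def unfolding M(2) using l1 by (intro mult_left_mono) auto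
qed

section \<open>Competing extremal products stay below the threshold\<close>

lemma estimate_ii: "t + 1 \<le> k \<Longrightarrow> l * (t + 1) < U"
  unfolding U_def using l1 mM half_inverse_le by (intro mult_strict_left_mono) auto

text \<open>The leading terms differ by \<open>(l - k) * (t + 1)\<close>. This is at least
  \<open>l\<close>, because \<open>k \<le> t\<close> and \<open>l - k \<ge> 1\<close>, and hence
  outweighs the correction in \<open>U\<close>.\<close>

lemma estimate_swapped_ii:
  assumes "k \<le> t" "k + 1 \<le> l"
  shows "k * (t + 1) < U"
proof -
  have M: "m = t + 1" "M = t + 1" using mM assms by auto
  have "l \<le> (l - k) * (t + 1)"
  proof -
    have "t * 1 \<le> t * (l - k)" using t1 assms by (intro mult_left_mono) auto
    then show ?thesis using assms(1) by (simp add: algebra_simps)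
  qed
  then have "l / (2 * (t + 1)) \<le> (l - k) / 2" using t1 by (simp add: field_simps)
  also have "\<dots> < (l - k) * (t + 1)"
    using assms t1 mult_strict_left_mono[of "1 / 2" "t + 1" "l - k"] by simp
  finally show ?thesis unfolding U_eq unfolding M(2) by (simp add: algebra_simps)
qed

text \<open>Here \<open>q\<close> stands for the binomial coefficient \<open>N choose k\<close>, and
  \<open>t / q\<close> accounts for the summand \<open>t\<close> in the product of the first
  configuration. The assumption leaves a gap of 1 between the leading factors \<open>k + 1\<close>
  and \<open>t + 1\<close>.\<close>

lemma estimate_i:
  assumes "k + 1 \<le> t" "N \<le> q"
  shows "l * (k + 1) * (1 + t / q) < U"
proof -
  have M: "m = t + 1" "M = t + 1" using mM assms by auto
  have "(k + 1) * t / q \<le> (k + 1) * t / N"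
    using assms N_pos t1 k1 by (intro divide_left_mono) auto
  also have "\<dots> \<le> 1 / 2 * ((t + 1) * (l + 1) * (k + 1)) / N"
  proof -
    have "(k + 1) * t * 2 \<le> (k + 1) * (t + 1) * (l + 1)" using t1 k1 l1 by (intro mult_mono) auto
    then show ?thesis using N_pos by (intro divide_right_mono) (auto simp: mult_ac)
  qed
  also have "\<dots> \<le> 1 / 2 / m" by (intro divide_N_le_divide_m) auto
  also have "\<dots> \<le> 1 / 4" using m2 by simp
  finally have "(k + 1) * (1 + t / q) \<le> t + 1 / 4"
    using assms(1) unfolding distrib_left times_divide_eq_right mult_1_right by linarith
  then have "(k + 1) * (1 + t / q) < M - 1 / (2 * (t + 1))" using half_inverse_le M by linarith
  then show ?thesis unfolding U_def using l1 by (simp add: mult.assoc)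
qed

lemma estimate_swapped_i:
  assumes "k \<le> t" "k + 1 \<le> l" "N \<le> p"
  shows "k * (l + 1) * (1 + t / p) < U"
proof -
  have M: "m = t + 1" "M = t + 1" using mM assms by auto
  have "k * (l + 1) * t / p \<le> k * (l + 1) * t / N"
    using assms N_pos t1 k1 l1 by (intro divide_left_mono) auto
  also have "\<dots> < 1 * ((t + 1) * (l + 1) * (k + 1)) / N"
  proof -
    have "(l + 1) * (k * t) < (l + 1) * ((k + 1) * (t + 1))"
      using t1 k1 l1 by (intro mult_strict_left_mono mult_strict_mono) auto
    then show ?thesis using N_pos by (intro divide_strict_right_mono) (auto simp: mult_ac)
  qed
  also have "\<dots> \<le> 1 / m" by (intro divide_N_le_divide_m) auto
  finally have 1: "k * (l + 1) * t / p < 1 / (t + 1)" using M by simp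
  \<comment> \<open>The left-over \<open>l * (t + 1) - k * (l + 1)\<close> equals
    \<open>l * (t + 1 - k) - k\<close>, hence is at least \<open>l - k\<close>. After multiplication
    by \<open>2 * (t + 1)\<close> it covers both correction terms, since
    \<open>2 * (k + 1) * (l - k) \<ge> l + 2\<close>.\<close>
  have 2: "k * (l + 1) + 1 / (t + 1) \<le> l * (t + 1) - l / (2 * (t + 1))"
  proof -
    have "l - k \<le> l * (t + 1 - k) - k"
      using mult_left_mono[of 1 "t + 1 - k" l] assms l1 by simp
    then have "2 * (k + 1) * (l - k) \<le> 2 * (t + 1) * (l * (t + 1 - k) - k)"
      using assms k1 by (intro mult_mono) auto
    moreover have "2 + l \<le> 2 * (k + 1) * (l - k)"
      using mult_mono[of 1 "l - k" 1 "2 * k + 1"] mult_left_mono[of 1 "l - k" k] assms k1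
      by (simp add: algebra_simps)
    ultimately have "k * (l + 1) * (2 * (t + 1)) + 2 + l \<le> l * (t + 1) * (2 * (t + 1))"
      by (simp add: algebra_simps)
    then have "(k * (l + 1) * (2 * (t + 1)) + 2 + l) / (2 * (t + 1)) \<le> l * (t + 1)"
      using t1 by (subst pos_divide_le_eq) auto
    moreover have "(k * (l + 1) * (2 * (t + 1)) + 2 + l) / (2 * (t + 1)) =
        k * (l + 1) + 1 / (t + 1) + l / (2 * (t + 1))"
      using t1 by (simp add: divide_simps) (simp add: algebra_simps)
    ultimately show ?thesis by linarith
  qed
  have "k * (l + 1) * (1 + t / p) = k * (l + 1) + k * (l + 1) * t / p"
    by (simp add: distrib_left)
  also have "\<dots> < l * (t + 1) - l / (2 * (t + 1))" using 1 2 by linarith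
  finally show ?thesis unfolding U_eq unfolding M(2) .
qed

end

section \<open>Bonferroni estimates for binomial coefficients\<close>

lemma real_binomial_pred:
  assumes "0 < a" "0 < N"
  shows "real ((N - 1) choose (a - 1)) = real (N choose a) * real a / real N"
proof -
  have "real (a * (N choose a)) = real (N * ((N - 1) choose (a - 1)))"
    using times_binomial_minus1_eq[OF assms(1), of N] by simp
  then show ?thesis using assms(2) by (simp add: field_simps)
qed

text \<open>The lower index is complementary, matching the form of \<open>card_star\<close>.\<close>

lemma real_binomial_absorb_comp:
  assumes "a \<le> N" "0 < N"
  shows "real ((N - 1) choose (N - a)) = real (N choose a) * real a / real N"
proof -
  have "real ((N - (N - a)) * (N choose (N - a))) = real (N * ((N - 1) choose (N - a)))"
    by (simp only: binomial_absorb_comp)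
  moreover have "N choose (N - a) = N choose a" using assms(1) by (rule binomial_symmetric[symmetric])
  moreover have "N - (N - a) = a" using assms(1) by simp
  ultimately show ?thesis using assms(2) by (simp add: field_simps)
qed

lemma real_binomial_absorb_comp2:
  assumes "a \<le> N" "0 < a" "1 < N"
  shows "real ((N - 2) choose (N - a)) = real (N choose a) * real a * (real a - 1) / (real N * (real N - 1))"
proof -
  have e: "real (N - 1) = real N - 1" "real (a - 1) = real a - 1" using assms by auto
  have "real ((N - 1 - 1) choose (N - 1 - (a - 1))) = real ((N - 1) choose (a - 1)) * real (a - 1) / real (N - 1)"
    using assms by (intro real_binomial_absorb_comp) auto
  then show ?thesis
    using assms e real_binomial_pred[of a N] by (simp add: numeral_2_eq_2)
qed

lemma binomial_diff_Suc:
  assumes "0 < a" "r < N"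
  shows "real ((N - Suc r) choose a) = real ((N - r) choose a) - real ((N - 1 - r) choose (a - 1))"
proof -
  obtain M where "N - r = Suc M" using assms(2) by (metis Suc_diff_Suc)
  moreover from this have "N - Suc r = M" "N - 1 - r = M" by auto
  moreover obtain b where "a = Suc b" using assms(1) by (metis gr0_implies_Suc)
  ultimately show ?thesis by simp
qed

text \<open>\<open>(N - r) choose a\<close> counts the \<open>a\<close>-subsets avoiding
  \<open>r\<close> given points, and each point lies in a fraction \<open>a / N\<close> of all
  \<open>a\<close>-subsets. The induction on \<open>r\<close> is Pascal's rule.\<close>

lemma binomial_diff_ge:
  assumes "r < N"
  shows "real (N choose a) * (1 - real r * real a / real N) \<le> real ((N - r) choose a)"
proof (cases "a = 0")
  case False
  then have a: "0 < a" by simp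
  show ?thesis using assms
  proof (induction r)
    case (Suc r)
    have "real ((N - 1 - r) choose (a - 1)) \<le> real ((N - 1) choose (a - 1))"
      by (simp add: binomial_right_mono)
    also have "\<dots> = real (N choose a) * real a / real N" using a Suc.prems by (intro real_binomial_pred) auto
    finally have "real (N choose a) * (1 - real r * real a / real N) - real (N choose a) * real a / real N
        \<le> real ((N - Suc r) choose a)"
      using Suc binomial_diff_Suc[OF a, of r N] by simp
    then show ?case by (simp add: algebra_simps add_divide_distrib)
  qed simp
qed simp

text \<open>The term subtracted by Pascal's rule has parameters \<open>N - 1\<close> and
  \<open>a - 1\<close>; the linear estimate for it produces the quadratic term here.\<close>

lemma binomial_diff_le:
  assumes "r + 1 < N"
  shows "real ((N - r) choose a) \<le> real (N choose a) *
    (1 - real r * real a / real N + real r * (real r - 1) / 2 * (real a * (real a - 1) / (real N * (real N - 1))))"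
proof (cases "a = 0")
  case False
  then have a: "0 < a" by simp
  show ?thesis using assms
  proof (induction r)
    case (Suc r)
    define P where "P = real (N choose a)"
    define x where "x = real a / real N"
    define y where "y = (real a - 1) / (real N - 1)"
    have e: "real (N - 1) = real N - 1" "real (a - 1) = real a - 1" using a Suc.prems by auto
    have P': "real ((N - 1) choose (a - 1)) = P * x"
      using a Suc.prems real_binomial_pred[of a N] by (simp add: P_def x_def)
    have h1: "P * x * (1 - real r * y) \<le> real ((N - 1 - r) choose (a - 1))"
      using binomial_diff_ge[of r "N - 1" "a - 1"] Suc.prems unfolding P' e y_def by simp
    have h2: "real ((N - r) choose a) \<le> P * (1 - real r * x + real r * (real r - 1) / 2 * (x * y))"
      using Suc by (simp add: P_def x_def y_def)
    have h3: "real ((N - Suc r) choose a) = real ((N - r) choose a) - real ((N - 1 - r) choose (a - 1))"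
      using Suc.prems by (intro binomial_diff_Suc a) simp
    have "real ((N - Suc r) choose a) \<le>
        P * (1 - real r * x + real r * (real r - 1) / 2 * (x * y)) - P * x * (1 - real r * y)"
      unfolding h3 using h2 h1 by (rule diff_mono)
    also have "\<dots> = P * (1 - real (Suc r) * x + real (Suc r) * (real (Suc r) - 1) / 2 * (x * y))"
      by (simp add: algebra_simps add_divide_distrib diff_divide_distrib)
    finally show ?case by (simp add: P_def x_def y_def)
  qed simp
qed simp

text \<open>The same induction once more, with the quadratic estimate applied to the term subtracted
  by Pascal's rule.\<close>

lemma binomial_diff_ge3:
  assumes "r + 2 < N"
  shows "real (N choose a) *
    (1 - real r * real a / real N + real r * (real r - 1) / 2 * (real a * (real a - 1) / (real N * (real N - 1)))
      - real r * (real r - 1) * (real r - 2) / 6 *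
        (real a * (real a - 1) * (real a - 2) / (real N * (real N - 1) * (real N - 2)))) \<le> real ((N - r) choose a)"
proof (cases "a = 0")
  case False
  then have a: "0 < a" by simp
  show ?thesis using assms
  proof (induction r)
    case (Suc r)
    define P where "P = real (N choose a)"
    define x where "x = real a / real N"
    define y where "y = (real a - 1) / (real N - 1)"
    define z where "z = (real a - 2) / (real N - 2)"
    have e: "real (N - 1) = real N - 1" "real (a - 1) = real a - 1" using a Suc.prems by auto
    have P': "real ((N - 1) choose (a - 1)) = P * x"
      using a Suc.prems real_binomial_pred[of a N] by (simp add: P_def x_def)
    have e2: "real N - 1 - 1 = real N - 2" "real a - 1 - 1 = real a - 2" by auto
    have h1: "real ((N - 1 - r) choose (a - 1)) \<le> P * x * (1 - real r * y + real r * (real r - 1) / 2 * (y * z))"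
      using binomial_diff_le[of r "N - 1" "a - 1"] Suc.prems unfolding P' e e2 y_def z_def by simp
    have h2: "P * (1 - real r * x + real r * (real r - 1) / 2 * (x * y)
        - real r * (real r - 1) * (real r - 2) / 6 * (x * y * z)) \<le> real ((N - r) choose a)"
      using Suc by (simp add: P_def x_def y_def z_def)
    have h3: "real ((N - Suc r) choose a) = real ((N - r) choose a) - real ((N - 1 - r) choose (a - 1))"
      using Suc.prems by (intro binomial_diff_Suc a) simp
    have "P * (1 - real r * x + real r * (real r - 1) / 2 * (x * y)
        - real r * (real r - 1) * (real r - 2) / 6 * (x * y * z)) -
        P * x * (1 - real r * y + real r * (real r - 1) / 2 * (y * z)) \<le> real ((N - Suc r) choose a)"
      unfolding h3 using h2 h1 by (rule diff_mono)
    moreover have "P * (1 - real (Suc r) * x + real (Suc r) * (real (Suc r) - 1) / 2 * (x * y)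
        - real (Suc r) * (real (Suc r) - 1) * (real (Suc r) - 2) / 6 * (x * y * z)) =
        P * (1 - real r * x + real r * (real r - 1) / 2 * (x * y)
        - real r * (real r - 1) * (real r - 2) / 6 * (x * y * z)) -
        P * x * (1 - real r * y + real r * (real r - 1) / 2 * (y * z))"
      by (simp add: algebra_simps add_divide_distrib diff_divide_distrib)
    ultimately show ?case by (simp add: P_def x_def y_def z_def)
  qed simp
qed simp

section \<open>Bounds on the product of the sizes\<close>

text \<open>One factor of the product of the two bounds from \<open>card_le_via_covers\<close>,
  after the binomial factors coming from the two covers have been exchanged. Each factor then
  depends on only one of the excesses \<open>i\<close> and \<open>j\<close>.\<close>

definition cover_bound :: "nat \<Rightarrow> nat \<Rightarrow> nat \<Rightarrow> nat \<Rightarrow> nat \<Rightarrow> nat" where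
  "cover_bound t b N l i = ((t + i) choose t) * ((b + 1) ^ i * ((N - i) choose (N - l)))"

text \<open>For \<open>i < l\<close> the ratio of consecutive values is
  \<open>(t + i + 1) * (b + 1) * (l - i) / ((i + 1) * (N - i))\<close>, which the lower bound on
  \<open>N\<close> keeps at most 1.\<close>

lemma cover_bound_antimono:
  assumes N: "(t + 1) * (b + 1) * l < N" and l: "0 < l" and ij: "i \<le> j"
  shows "cover_bound t b N l j \<le> cover_bound t b N l i"
proof -
  have "1 * 1 * l \<le> (t + 1) * (b + 1) * l" by (intro mult_le_mono) auto
  then have lN: "l < N" using N by simp
  have step: "cover_bound t b N l (Suc i) \<le> cover_bound t b N l i" for i
  proof (cases "i < l")
    case False
    \<comment> \<open>Beyond \<open>l\<close> the binomial coefficient vanishes.\<close>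
    then have "N - Suc i < N - l"
      using lN l by linarith
    then show ?thesis by (simp add: cover_bound_def binomial_eq_0)
  next
    case True
    define c where "c = (N - i) choose (N - l)"
    have c: "(N - i) * ((N - Suc i) choose (N - l)) = (l - i) * c"
      using binomial_absorb_comp[of "N - i" "N - l"] True lN by (simp add: c_def)
    have d: "Suc i * ((t + Suc i) choose t) = (t + Suc i) * ((t + i) choose t)"
    proof -
      have "Suc i * (Suc (t + i) choose Suc i) = Suc (t + i) * ((t + i) choose i)"
        by (rule Suc_times_binomial)
      moreover have "Suc (t + i) choose Suc i = (t + Suc i) choose t"
        using binomial_symmetric[of t "t + Suc i"] by simp
      moreover have "(t + i) choose i = (t + i) choose t" using binomial_symmetric[of t "t + i"] by simp
      ultimately show ?thesis by simp
    qed
    have key: "(t + Suc i) * (b + 1) * (l - i) \<le> Suc i * (N - i)"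
    proof -
      have "(t + 1) * (b + 1) * (l - i) + i \<le> (t + 1) * (b + 1) * (l - i) + (t + 1) * (b + 1) * i" by simp
      also have "\<dots> = (t + 1) * (b + 1) * l"
        using True by (simp only: distrib_left[symmetric]) simp
      finally have "(t + 1) * (b + 1) * (l - i) \<le> N - i" using N by simp
      then have "Suc i * ((t + 1) * (b + 1) * (l - i)) \<le> Suc i * (N - i)" by (rule mult_le_mono2)
      moreover have "(t + Suc i) * ((b + 1) * (l - i)) \<le> (Suc i * (t + 1)) * ((b + 1) * (l - i))"
        by (intro mult_le_mono1) simp
      ultimately show ?thesis by (simp only: mult.assoc)
    qed
    have "Suc i * (N - i) * cover_bound t b N l (Suc i) =
        (Suc i * ((t + Suc i) choose t)) * ((b + 1) ^ Suc i * ((N - i) * ((N - Suc i) choose (N - l))))"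
      by (simp only: cover_bound_def mult_ac)
    also have "\<dots> = ((t + Suc i) * (b + 1) * (l - i)) * cover_bound t b N l i"
      unfolding c d by (simp only: cover_bound_def c_def power_Suc mult_ac)
    also have "\<dots> \<le> Suc i * (N - i) * cover_bound t b N l i" using key by (rule mult_le_mono1)
    finally show ?thesis using True lN by simp
  qed
  show ?thesis using ij by (induction rule: dec_induct) (auto intro: order_trans step)
qed

locale size_params =
  fixes N l k t :: nat
  assumes t_pos: "0 < t" and k_pos: "0 < k" and k_le_l: "k \<le> l"
    and N_large: "max (t + 1) k * (t + 1) * (l + 1) * (k + 1) + 1 \<le> N"
begin

abbreviation "m \<equiv> max (t + 1) k"

text \<open>For integers either \<open>k \<le> t\<close> or \<open>t + 1 \<le> k\<close>, so the two
  maxima realise the case distinction assumed for \<open>m\<close> and \<open>M\<close>.\<close>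

sublocale size_estimates "real N" "real l" "real k" "real t" "real m" "real (max t k) + 1"
proof
  have "real (m * (t + 1) * (l + 1) * (k + 1) + 1) \<le> real N" using N_large by (simp only: of_nat_le_iff)
  then show "real m * (real t + 1) * (real l + 1) * (real k + 1) \<le> real N - 1"
    by (simp only: of_nat_add of_nat_mult of_nat_1 le_diff_eq)
qed (use t_pos k_pos k_le_l in auto)

text \<open>\<open>P\<close> and \<open>Q\<close> are the numbers of
  \<open>k\<^sub>1\<close>-subsets and \<open>k\<^sub>2\<close>-subsets through a fixed
  \<open>t\<close>-set; \<open>W\<close> is the threshold \<open>U\<close> converted back into a
  number of pairs.\<close>

definition P :: real where "P = real (N choose l)"
definition Q :: real where "Q = real (N choose k)"
definition W :: real where "W = P * Q / real N * U"

lemma N_gt: "m * (t + 1) * (l + 1) * (k + 1) < N"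
  using N_large by linarith

lemma mult_Suc_l_less_N: "c \<le> m * (t + 1) * (k + 1) \<Longrightarrow> c * (l + 1) < N"
proof -
  assume "c \<le> m * (t + 1) * (k + 1)"
  then have "c * (l + 1) \<le> m * (t + 1) * (k + 1) * (l + 1)" by (rule mult_le_mono1)
  also have "\<dots> = m * (t + 1) * (l + 1) * (k + 1)" by (simp only: mult_ac)
  also have "\<dots> < N" by (rule N_gt)
  finally show ?thesis .
qed

lemma N_bounds: "l < N" "k < N" "2 * l \<le> N" "2 * k \<le> N" "2 < N" "l + k + 3 < N"
    "(t + 1) * (k + 1) * l < N" "(t + 1) * (l + 1) * k < N"
proof -
  have "2 * 2 * 2 \<le> m * (t + 1) * (k + 1)" using t_pos k_pos by (intro mult_le_mono) auto
  then have 1: "8 * (l + 1) < N" using mult_Suc_l_less_N by simp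
  then show "l < N" "k < N" "2 * l \<le> N" "2 * k \<le> N" "2 < N" "l + k + 3 < N" using k_le_l by auto
  have "1 * ((t + 1) * (k + 1)) \<le> m * ((t + 1) * (k + 1))" by (intro mult_le_mono1) auto
  then have 2: "(t + 1) * (k + 1) * (l + 1) < N" by (intro mult_Suc_l_less_N) (simp only: mult.assoc mult_1)
  have "(t + 1) * (k + 1) * l \<le> (t + 1) * (k + 1) * (l + 1)" by (intro mult_le_mono2) auto
  then show "(t + 1) * (k + 1) * l < N" using 2 by linarith
  have "(t + 1) * (l + 1) * k \<le> (t + 1) * (l + 1) * (k + 1)" by (intro mult_le_mono2) auto
  also have "\<dots> = (t + 1) * (k + 1) * (l + 1)" by (simp only: mult_ac)
  finally show "(t + 1) * (l + 1) * k < N" using 2 by linarith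
qed

lemma PQ_ge: "real N \<le> P" "real N \<le> Q" "0 < P" "0 < Q"
proof -
  have "N choose 1 \<le> N choose l" "N choose 1 \<le> N choose k"
    using k_pos k_le_l N_bounds by (auto intro!: binomial_mono simp del: binomial_1)
  then show "real N \<le> P" "real N \<le> Q" by (auto simp: P_def Q_def)
  then show "0 < P" "0 < Q" using N_bounds by auto
qed

lemma U_pos: "0 < U"
  unfolding U_def using l1 M2 half_inverse_le by (intro mult_pos_pos) linarith+

lemma W_pos: "0 < W"
  using PQ_ge U_pos N_bounds by (simp add: W_def)

lemma less_W: "e < U \<Longrightarrow> z \<le> P * Q / real N * e \<Longrightarrow> z < W"
  unfolding W_def using PQ_ge N_bounds
  by (elim le_less_trans, intro mult_strict_left_mono) auto

lemma real_star_binomials: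
  "real ((N - 1) choose (N - l)) = P * real l / real N"
  "real ((N - 1) choose (N - k)) = Q * real k / real N"
  "real ((N - 2) choose (N - l)) = P * real l * (real l - 1) / (real N * (real N - 1))"
  "real ((N - 2) choose (N - k)) = Q * real k * (real k - 1) / (real N * (real N - 1))"
  "real (N choose (N - l)) = P" "real (N choose (N - k)) = Q"
proof -
  show "real (N choose (N - l)) = P" "real (N choose (N - k)) = Q"
    using binomial_symmetric[of l N] binomial_symmetric[of k N] N_bounds by (auto simp: P_def Q_def)
qed (use N_bounds k_pos k_le_l in \<open>auto simp: P_def Q_def real_binomial_absorb_comp[simplified]
    real_binomial_absorb_comp2[simplified]\<close>)

lemma real_choose_add_2: "real ((t + 2) choose t) = (real t + 2) * (real t + 1) / 2"
proof -
  have "(t + 2) choose t = (t + 2) choose 2" using binomial_symmetric[of t "t + 2"] by simp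
  also have "\<dots> = (t + 2) * (t + 1) div 2" by (simp add: choose_two)
  finally have "real ((t + 2) choose t) = real ((t + 2) * (t + 1) div 2)" by simp
  also have "\<dots> = real ((t + 2) * (t + 1)) / real 2" by (rule real_of_nat_div) simp
  finally show ?thesis by (simp only: of_nat_mult of_nat_add of_nat_1 of_nat_numeral)
qed

lemma real_cover_bound:
  "real (cover_bound t b N a i) = real ((t + i) choose t) * ((real b + 1) ^ i * real ((N - i) choose (N - a)))"
  by (simp only: cover_bound_def of_nat_mult of_nat_power of_nat_add of_nat_1)

lemma real_cover_bounds:
  "real (cover_bound t k N l 0) = P"
  "real (cover_bound t l N k 0) = Q"
  "real (cover_bound t k N l 1) = (real t + 1) * ((real k + 1) * (P * real l / real N))"
  "real (cover_bound t l N k 1) = (real t + 1) * ((real l + 1) * (Q * real k / real N))"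
  "real (cover_bound t k N l 2) =
    (real t + 2) * (real t + 1) / 2 * ((real k + 1)\<^sup>2 * (P * real l * (real l - 1) / (real N * (real N - 1))))"
  "real (cover_bound t l N k 2) =
    (real t + 2) * (real t + 1) / 2 * ((real l + 1)\<^sup>2 * (Q * real k * (real k - 1) / (real N * (real N - 1))))"
  unfolding real_cover_bound real_star_binomials real_choose_add_2 using real_star_binomials(5,6) by simp_all

section \<open>Non-extremal cases in terms of actual sizes\<close>

lemma small_1_1:
  assumes "z \<le> cover_bound t k N l 1 * cover_bound t l N k 1"
  shows "real z < W"
proof (rule less_W[OF estimate_1_1])
  have "real z \<le> real (cover_bound t k N l 1 * cover_bound t l N k 1)" using assms by (rule of_nat_mono)
  also have "\<dots> = (real t + 1) * ((real k + 1) * (P * real l / real N)) *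
      ((real t + 1) * ((real l + 1) * (Q * real k / real N)))"
    by (simp only: of_nat_mult real_cover_bounds)
  also have "\<dots> = P * Q / real N * ((real t + 1)\<^sup>2 * (real k + 1) * (real l + 1) * real l * real k / real N)"
    by (simp add: power2_eq_square mult_ac)
  finally show "real z \<le> P * Q / real N * ((real t + 1)\<^sup>2 * (real k + 1) * (real l + 1) * real l * real k / real N)" .
qed

lemma small_2_0:
  assumes "z \<le> cover_bound t k N l 2 * cover_bound t l N k 0"
  shows "real z < W"
proof (rule less_W[OF estimate_2_0])
  have "real z \<le> real (cover_bound t k N l 2 * cover_bound t l N k 0)" using assms by (rule of_nat_mono)
  also have "\<dots> = (real t + 2) * (real t + 1) / 2 * ((real k + 1)\<^sup>2 *
      (P * real l * (real l - 1) / (real N * (real N - 1)))) * Q"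
    by (simp only: of_nat_mult real_cover_bounds)
  also have "\<dots> = P * Q / real N * ((real t + 2) * (real t + 1) / 2 * (real k + 1)\<^sup>2 * real l * (real l - 1) / (real N - 1))"
    by (simp add: mult_ac)
  finally show "real z \<le> P * Q / real N * ((real t + 2) * (real t + 1) / 2 * (real k + 1)\<^sup>2 * real l * (real l - 1) / (real N - 1))" .
qed

lemma small_0_2:
  assumes "z \<le> cover_bound t k N l 0 * cover_bound t l N k 2"
  shows "real z < W"
proof (rule less_W[OF estimate_0_2])
  have "real z \<le> real (cover_bound t k N l 0 * cover_bound t l N k 2)" using assms by (rule of_nat_mono)
  also have "\<dots> = P * ((real t + 2) * (real t + 1) / 2 * ((real l + 1)\<^sup>2 *
      (Q * real k * (real k - 1) / (real N * (real N - 1)))))"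
    by (simp only: of_nat_mult real_cover_bounds)
  also have "\<dots> = P * Q / real N * ((real t + 2) * (real t + 1) / 2 * (real l + 1)\<^sup>2 * real k * (real k - 1) / (real N - 1))"
    by (simp add: mult_ac)
  finally show "real z \<le> P * Q / real N * ((real t + 2) * (real t + 1) / 2 * (real l + 1)\<^sup>2 * real k * (real k - 1) / (real N - 1))" .
qed

text \<open>By monotonicity in each excess only the minimal cases (1, 1), (2, 0) and (0, 2) have to
  be estimated.\<close>

lemma small_cover_bound:
  assumes z: "z \<le> cover_bound t k N l i * cover_bound t l N k j"
    and ij: "1 \<le> i \<and> 1 \<le> j \<or> 2 \<le> i \<or> 2 \<le> j"
  shows "real z < W"
proof -
  have *: "z \<le> cover_bound t k N l i' * cover_bound t l N k j'" if "i' \<le> i" "j' \<le> j" for i' j'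
  proof -
    have "cover_bound t k N l i \<le> cover_bound t k N l i'" "cover_bound t l N k j \<le> cover_bound t l N k j'"
      using that N_bounds k_pos k_le_l by (auto intro!: cover_bound_antimono)
    then show ?thesis using z by (meson le_trans mult_le_mono)
  qed
  from ij show ?thesis
  proof (elim disjE conjE)
    assume "1 \<le> i" "1 \<le> j" then show ?thesis using small_1_1 * by blast
  next
    assume "2 \<le> i" then show ?thesis using small_2_0 *[of 2 0] by blast
  next
    assume "2 \<le> j" then show ?thesis using small_0_2 *[of 0 2] by blast
  qed
qed

text \<open>This serves the case of excesses (0, 0): non-triviality permits one branching step on
  each side, and the result is below the bound for (1, 1).\<close>

lemma small_single_steps:
  assumes "x \<le> (k + 1) * ((N - 1) choose (N - l))" "y \<le> (l + 1) * ((N - 1) choose (N - k))"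
  shows "real (x * y) < W"
proof (rule small_1_1)
  have "x \<le> cover_bound t k N l 1"
    using assms(1) unfolding cover_bound_def by (rule order_trans) simp
  moreover have "y \<le> cover_bound t l N k 1"
    using assms(2) unfolding cover_bound_def by (rule order_trans) simp
  ultimately show "x * y \<le> cover_bound t k N l 1 * cover_bound t l N k 1" by (rule mult_le_mono)
qed

lemma choose_add_2_ge: "t + 1 \<le> (t + 2) choose t"
proof -
  have "(t + 2) choose t = (t + 2) choose 2" using binomial_symmetric[of t "t + 2"] by simp
  then show ?thesis by (simp add: numeral_2_eq_2)
qed

text \<open>The case of empty \<open>A\<close>. The factor \<open>t + 1\<close> is at most
  \<open>(t + 2) choose t\<close>, so the bound for excesses (2, 0) applies.\<close>

lemma small_no_common:
  assumes "x \<le> (k + 1) * ((k + 1) * ((N - 2) choose (N - l)))" "y \<le> (t + 1) * (N choose (N - k))"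
  shows "real (x * y) < W"
proof (rule small_2_0)
  have "x * y \<le> ((k + 1) * ((k + 1) * ((N - 2) choose (N - l)))) * ((t + 1) * (N choose (N - k)))"
    using assms by (rule mult_le_mono)
  also have "\<dots> = (t + 1) * ((k + 1) ^ 2 * ((N - 2) choose (N - l))) * (N choose (N - k))"
    by (simp only: power2_eq_square mult_ac)
  also have "\<dots> \<le> ((t + 2) choose t) * ((k + 1) ^ 2 * ((N - 2) choose (N - l))) * (N choose (N - k))"
    using choose_add_2_ge by (intro mult_le_mono1)
  also have "\<dots> = cover_bound t k N l 2 * cover_bound t l N k 0" by (simp add: cover_bound_def)
  finally show "x * y \<le> cover_bound t k N l 2 * cover_bound t l N k 0" .
qed

lemma small_no_common_swapped:
  assumes "y \<le> (l + 1) * ((l + 1) * ((N - 2) choose (N - k)))" "x \<le> (t + 1) * (N choose (N - l))"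
  shows "real (x * y) < W"
proof (rule small_0_2)
  have "x * y \<le> ((t + 1) * (N choose (N - l))) * ((l + 1) * ((l + 1) * ((N - 2) choose (N - k))))"
    using assms(2,1) by (rule mult_le_mono)
  also have "\<dots> = (t + 1) * ((N choose (N - l)) * ((l + 1) ^ 2 * ((N - 2) choose (N - k))))"
    by (simp only: power2_eq_square mult_ac)
  also have "\<dots> \<le> ((t + 2) choose t) * ((N choose (N - l)) * ((l + 1) ^ 2 * ((N - 2) choose (N - k))))"
    using choose_add_2_ge by (intro mult_le_mono1)
  also have "\<dots> = cover_bound t k N l 0 * cover_bound t l N k 2" by (simp add: cover_bound_def)
  finally show "x * y \<le> cover_bound t k N l 0 * cover_bound t l N k 2" .
qed

text \<open>Relative to a branch inside \<open>A\<close>, the estimate for a branch outside has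
  weight at most \<open>e \<le> 1\<close>. The bound on \<open>x\<close> therefore grows with
  \<open>a\<close>, and \<open>a = k\<close> is the worst case.\<close>

lemma small_mid:
  assumes a: "1 \<le> a" "a \<le> k"
    and x: "x \<le> a * ((N - 1) choose (N - l)) + (k + 1 - a) * ((k + 1) * ((N - 2) choose (N - l)))"
    and y: "y \<le> (N choose (N - k)) + t * (l * ((N - 1) choose (N - k)))"
  shows "real (x * y) < W"
proof -
  define e where "e = (real k + 1) * (real l - 1) / (real N - 1)"
  have "(k + 1) * l \<le> (t + 1) * (k + 1) * l" by simp
  then have "real ((k + 1) * l) \<le> real N - 1" using N_bounds by linarith
  then have "(real k + 1) * (real l - 1) \<le> real N - 1" by (simp add: algebra_simps)
  then have e1: "e \<le> 1" using N_bounds by (simp add: e_def)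
  have "real x \<le> real a * (P * real l / real N) +
      (real k + 1 - real a) * ((real k + 1) * (P * real l * (real l - 1) / (real N * (real N - 1))))"
  proof -
    have "real (k + 1 - a) = real k + 1 - real a" using a by simp
    then show ?thesis
      using of_nat_mono[OF x, where 'a = real] by (simp only: of_nat_add of_nat_mult of_nat_1 real_star_binomials)
  qed
  also have "\<dots> = P * real l / real N * (real a + (real k + 1 - real a) * e)"
    by (simp add: e_def distrib_left add_divide_distrib mult_ac)
  also have "\<dots> \<le> P * real l / real N * (real k + e)"
  proof (rule mult_left_mono)
    have "(real k - real a) * e \<le> (real k - real a) * 1" using a e1 by (intro mult_left_mono) auto
    then show "real a + (real k + 1 - real a) * e \<le> real k + e" by (simp add: algebra_simps)
  qed (use PQ_ge in simp)
  finally have x': "real x \<le> P * real l / real N * (real k + e)" .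
  have "real y \<le> Q + real t * (real l * (Q * real k / real N))"
    using of_nat_mono[OF y, where 'a = real] by (simp only: of_nat_add of_nat_mult real_star_binomials)
  then have y': "real y \<le> Q * (1 + real t * real l * real k / real N)" by (simp add: distrib_left mult_ac)
  have "real (x * y) \<le> P * real l / real N * (real k + e) * (Q * (1 + real t * real l * real k / real N))"
    unfolding of_nat_mult using x' y' by (intro mult_mono order_trans[OF _ x']) auto
  then have "real (x * y) \<le> P * Q / real N * (real l * (real k + e) * (1 + real t * real l * real k / real N))"
    by (simp add: mult_ac)
  moreover have "real l * (real k + e) * (1 + real t * real l * real k / real N) < U"
    by (intro estimate_mid) (auto simp: e_def)
  ultimately show ?thesis using less_W by blast
qed

lemma small_mid_swapped:
  assumes a: "1 \<le> a" "a \<le> l"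
    and y: "y \<le> a * ((N - 1) choose (N - k)) + (l + 1 - a) * ((l + 1) * ((N - 2) choose (N - k)))"
    and x: "x \<le> (N choose (N - l)) + t * (k * ((N - 1) choose (N - l)))"
  shows "real (x * y) < W"
proof -
  define e where "e = (real l + 1) * (real k - 1) / (real N - 1)"
  have "(l + 1) * k \<le> (t + 1) * (l + 1) * k" by simp
  then have "real ((l + 1) * k) \<le> real N - 1" using N_bounds by linarith
  then have "(real l + 1) * (real k - 1) \<le> real N - 1" by (simp add: algebra_simps)
  then have e1: "e \<le> 1" using N_bounds by (simp add: e_def)
  have "real y \<le> real a * (Q * real k / real N) +
      (real l + 1 - real a) * ((real l + 1) * (Q * real k * (real k - 1) / (real N * (real N - 1))))"
  proof -
    have "real (l + 1 - a) = real l + 1 - real a" using a by simp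
    then show ?thesis
      using of_nat_mono[OF y, where 'a = real] by (simp only: of_nat_add of_nat_mult of_nat_1 real_star_binomials)
  qed
  also have "\<dots> = Q * real k / real N * (real a + (real l + 1 - real a) * e)"
    by (simp add: e_def distrib_left add_divide_distrib mult_ac)
  also have "\<dots> \<le> Q * real k / real N * (real l + e)"
  proof (rule mult_left_mono)
    have "(real l - real a) * e \<le> (real l - real a) * 1" using a e1 by (intro mult_left_mono) auto
    then show "real a + (real l + 1 - real a) * e \<le> real l + e" by (simp add: algebra_simps)
  qed (use PQ_ge in simp)
  also have "\<dots> = Q / real N * (real k * (real l + e))" by simp
  \<comment> \<open>Here \<open>l\<close> is extracted instead of \<open>k\<close>, to reach the
    form \<open>l * x * y\<close> of \<open>estimate_mid\<close>.\<close>
  also have "real k * (real l + e) = real l * (real k + real k * e / real l)"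
    using l1 by (simp add: distrib_left)
  also have "Q / real N * \<dots> = Q * real l / real N * (real k + real k * e / real l)" by simp
  finally have y': "real y \<le> Q * real l / real N * (real k + real k * e / real l)" .
  have "real x \<le> P + real t * (real k * (P * real l / real N))"
    using of_nat_mono[OF x, where 'a = real] by (simp only: of_nat_add of_nat_mult real_star_binomials)
  then have x': "real x \<le> P * (1 + real t * real l * real k / real N)" by (simp add: distrib_left mult_ac)
  have "real (x * y) \<le> (P * (1 + real t * real l * real k / real N)) * (Q * real l / real N * (real k + real k * e / real l))"
    unfolding of_nat_mult using x' y' by (intro mult_mono order_trans[OF _ x']) auto
  then have "real (x * y) \<le> P * Q / real N * (real l * (real k + real k * e / real l) * (1 + real t * real l * real k / real N))"
    by (simp add: mult_ac)
  moreover have "real l * (real k + real k * e / real l) * (1 + real t * real l * real k / real N) < U"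
  proof (rule estimate_mid)
    \<comment> \<open>Since \<open>k \<le> l\<close>, the correction of the swapped case is no
      larger than that of the original one.\<close>
    have "real k * (real l + 1) * (real k - 1) \<le> (real l * (real k + 1)) * (real l - 1)"
      by (rule mult_mono) (use k_le_l k1 l1 in \<open>auto simp: algebra_simps\<close>)
    then have "real k * ((real l + 1) * (real k - 1)) / real l \<le> (real k + 1) * (real l - 1)"
      using l1 by (simp add: field_simps)
    then have "real k * ((real l + 1) * (real k - 1)) / real l / (real N - 1) \<le> (real k + 1) * (real l - 1) / (real N - 1)"
      using N_pos by (intro divide_right_mono) auto
    then show "real k + real k * e / real l \<le> real k + (real k + 1) * (real l - 1) / (real N - 1)"
      by (simp add: e_def mult.commute)
  qed auto
  ultimately show ?thesis using less_W by blast
qed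

section \<open>Comparison of the extremal products\<close>

definition bound_i :: nat where
  "bound_i = ((N choose l) - ((N - k - 1) choose l)) * ((N choose k) + t)"
definition bound_ii :: nat where
  "bound_ii = ((N - 1) choose (l - 1)) * ((t + 1) * ((N - 1) choose k) + ((N - 1) choose (k - 1)))"
text \<open>Together with \<open>swapped_bound_ii\<close> this gives the products when the two
  families exchange their roles; both agree with the original products if
  \<open>l = k\<close>.\<close>

definition swapped_bound_i :: nat where
  "swapped_bound_i = ((N choose k) - ((N - l - 1) choose k)) * ((N choose l) + t)"
definition swapped_bound_ii :: nat where
  "swapped_bound_ii = ((N - 1) choose (k - 1)) * ((t + 1) * ((N - 1) choose l) + ((N - 1) choose (l - 1)))"

section \<open>Closed forms and upper estimates of the four extremal products\<close>

lemma real_bound_i: "real bound_i = (P - real ((N - (k + 1)) choose l)) * (Q + real t)"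
  using binomial_right_mono[of "N - (k + 1)" N l] by (simp add: bound_i_def P_def Q_def of_nat_diff)

lemma real_swapped_bound_i: "real swapped_bound_i = (Q - real ((N - (l + 1)) choose k)) * (P + real t)"
  using binomial_right_mono[of "N - (l + 1)" N k] by (simp add: swapped_bound_i_def P_def Q_def of_nat_diff)

lemma pred_binomials:
  "real ((N - 1) choose (l - 1)) = P * real l / real N"
  "real ((N - 1) choose (k - 1)) = Q * real k / real N"
  "real ((N - 1) choose l) = P * (1 - real l / real N)"
  "real ((N - 1) choose k) = Q * (1 - real k / real N)"
proof -
  show 1: "real ((N - 1) choose (l - 1)) = P * real l / real N"
    unfolding P_def using N_bounds k_pos k_le_l by (intro real_binomial_pred) auto
  show 2: "real ((N - 1) choose (k - 1)) = Q * real k / real N"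
    unfolding Q_def using N_bounds k_pos by (intro real_binomial_pred) auto
  show "real ((N - 1) choose l) = P * (1 - real l / real N)"
    using binomial_diff_Suc[of l 0 N] 1 N_bounds k_pos k_le_l by (simp add: P_def right_diff_distrib)
  show "real ((N - 1) choose k) = Q * (1 - real k / real N)"
    using binomial_diff_Suc[of k 0 N] 2 N_bounds k_pos by (simp add: Q_def right_diff_distrib)
qed

lemma real_bound_ii:
  "real bound_ii = P * Q / real N * (real l * (real t + 1 - real t * real k / real N))"
proof -
  have "real bound_ii = P * real l / real N *
      ((real t + 1) * (Q * (1 - real k / real N)) + Q * real k / real N)"
    by (simp only: bound_ii_def of_nat_mult of_nat_add of_nat_1 pred_binomials)
  also have "\<dots> = P * Q / real N * (real l * (real t + 1 - real t * real k / real N))"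
    by (simp add: algebra_simps add_divide_distrib diff_divide_distrib)
  finally show ?thesis .
qed

lemma real_swapped_bound_ii:
  "real swapped_bound_ii = P * Q / real N * (real k * (real t + 1 - real t * real l / real N))"
proof -
  have "real swapped_bound_ii = Q * real k / real N *
      ((real t + 1) * (P * (1 - real l / real N)) + P * real l / real N)"
    by (simp only: swapped_bound_ii_def of_nat_mult of_nat_add of_nat_1 pred_binomials)
  also have "\<dots> = P * Q / real N * (real k * (real t + 1 - real t * real l / real N))"
    by (simp add: algebra_simps add_divide_distrib diff_divide_distrib)
  finally show ?thesis .
qed

lemma bound_i_le: "real bound_i \<le> P * Q / real N * (real l * (real k + 1) * (1 + real t / Q))"
proof -
  have "P * (1 - real (k + 1) * real l / real N) \<le> real ((N - (k + 1)) choose l)"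
    unfolding P_def using N_bounds by (intro binomial_diff_ge) auto
  then have "P - real ((N - (k + 1)) choose l) \<le> P * ((real k + 1) * real l / real N)"
    by (simp add: right_diff_distrib add.commute)
  then have "real bound_i \<le> P * ((real k + 1) * real l / real N) * (Q + real t)"
    unfolding real_bound_i using PQ_ge by (intro mult_right_mono) auto
  also have "\<dots> = P * Q / real N * (real l * (real k + 1) * (1 + real t / Q))"
    using PQ_ge(4) N_bounds by (simp add: field_simps)
  finally show ?thesis .
qed

lemma swapped_bound_i_le: "real swapped_bound_i \<le> P * Q / real N * (real k * (real l + 1) * (1 + real t / P))"
proof -
  have "Q * (1 - real (l + 1) * real k / real N) \<le> real ((N - (l + 1)) choose k)"
    unfolding Q_def using N_bounds by (intro binomial_diff_ge) auto
  then have "Q - real ((N - (l + 1)) choose k) \<le> Q * ((real l + 1) * real k / real N)"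
    by (simp add: right_diff_distrib add.commute)
  then have "real swapped_bound_i \<le> Q * ((real l + 1) * real k / real N) * (P + real t)"
    unfolding real_swapped_bound_i using PQ_ge by (intro mult_right_mono) auto
  also have "\<dots> = P * Q / real N * (real k * (real l + 1) * (1 + real t / P))"
    using PQ_ge(3) N_bounds by (simp add: field_simps)
  finally show ?thesis .
qed

section \<open>The four extremal products against the threshold and each other\<close>

lemma W_le_bound_i:
  assumes "t + 1 \<le> k"
  shows "W \<le> real bound_i"
proof -
  define e where "e = real l * (real l - 1) / (real N * (real N - 1))"
  have "real ((N - (k + 1)) choose l) \<le>
      P * (1 - real (k + 1) * real l / real N + real (k + 1) * (real (k + 1) - 1) / 2 * e)"
    unfolding P_def e_def using N_bounds by (intro binomial_diff_le) auto
  then have 1: "P * (real (k + 1) * real l / real N - real (k + 1) * (real (k + 1) - 1) / 2 * e) \<le>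
      P - real ((N - (k + 1)) choose l)"
    by (simp add: algebra_simps)
  have "W \<le> P * Q / real N * (real l * (real k + 1 - (real k + 1) * real k * (real l - 1) / (2 * (real N - 1))))"
    unfolding W_def using PQ_ge assms by (intro mult_left_mono target_i) auto
  also have "\<dots> = P * (real (k + 1) * real l / real N - real (k + 1) * (real (k + 1) - 1) / 2 * e) * Q"
    by (simp add: e_def algebra_simps add_divide_distrib diff_divide_distrib)
  also have "\<dots> \<le> (P - real ((N - (k + 1)) choose l)) * Q"
    using 1 PQ_ge by (intro mult_right_mono) auto
  \<comment> \<open>The summand \<open>t\<close> in the second factor is given away.\<close>
  also have "\<dots> \<le> real bound_i"
  proof -
    have "real ((N - (k + 1)) choose l) \<le> P"
      unfolding P_def of_nat_le_iff by (intro binomial_right_mono) simp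
    then show ?thesis unfolding real_bound_i using PQ_ge by (intro mult_left_mono) auto
  qed
  finally show ?thesis .
qed

lemma W_le_bound_ii: "k \<le> t \<Longrightarrow> W \<le> real bound_ii"
  unfolding W_def real_bound_ii using PQ_ge by (intro mult_left_mono target_ii) auto

text \<open>Both leading terms are at most \<open>l * (t + 1)\<close>, whereas the threshold is
  close to \<open>l * (k + 1)\<close>.\<close>

lemma bound_ii_small:
  assumes "t + 1 \<le> k"
  shows "real bound_ii < W" "real swapped_bound_ii < W"
proof -
  have e: "real l * (real t + 1) < U" using assms by (intro estimate_ii) auto
  have "real l * (real t + 1 - real t * real k / real N) \<le> real l * (real t + 1)"
    by (intro mult_left_mono) auto
  then show "real bound_ii < W"
    unfolding real_bound_ii using PQ_ge by (intro less_W[OF e] mult_left_mono) auto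
  have "real k * (real t + 1 - real t * real l / real N) \<le> real l * (real t + 1)"
    using k_le_l by (intro order_trans[OF mult_left_mono mult_right_mono]) auto
  then show "real swapped_bound_ii < W"
    unfolding real_swapped_bound_ii using PQ_ge by (intro less_W[OF e] mult_left_mono) auto
qed

lemma swapped_small:
  assumes "k \<le> t" "k < l"
  shows "real swapped_bound_ii < W" "real swapped_bound_i < W"
proof -
  have e: "real k * (real t + 1) < U" using assms by (intro estimate_swapped_ii) auto
  have "real k * (real t + 1 - real t * real l / real N) \<le> real k * (real t + 1)"
    by (intro mult_left_mono) auto
  then show "real swapped_bound_ii < W"
    unfolding real_swapped_bound_ii using PQ_ge by (intro less_W[OF e] mult_left_mono) auto
  have "real k * (real l + 1) * (1 + real t / P) < U"
    using assms PQ_ge by (intro estimate_swapped_i) auto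
  then show "real swapped_bound_i < W" using swapped_bound_i_le by (rule less_W)
qed

text \<open>Expanding both products, the main terms are compared through
  \<open>C(N - 1, k) C(N - 1 - k, l) = C(N - 1, l) C(N - 1 - l, k)\<close>.\<close>

lemma swapped_bound_i_less:
  assumes "t + 1 \<le> k" "k < l"
  shows "swapped_bound_i < bound_i"
proof -
  define a where "a = real ((N - (k + 1)) choose l)"
  define b where "b = real ((N - (l + 1)) choose k)"
  define c where "c = real ((N - 1) choose k) * a"
  have c: "c = real ((N - 1) choose l) * b"
  proof -
    have "((N - 1) choose (l + k)) * ((l + k) choose k) = ((N - 1) choose k) * ((N - 1 - k) choose (l + k - k))"
      using N_bounds by (intro choose_mult) auto
    moreover have "((N - 1) choose (l + k)) * ((l + k) choose l) = ((N - 1) choose l) * ((N - 1 - l) choose (l + k - l))"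
      using N_bounds by (intro choose_mult) auto
    moreover have "(l + k) choose k = (l + k) choose l" using binomial_symmetric[of k "l + k"] by simp
    ultimately have "((N - 1) choose k) * ((N - (k + 1)) choose l) = ((N - 1) choose l) * ((N - (l + 1)) choose k)"
      by simp
    then show ?thesis unfolding c_def a_def b_def of_nat_mult[symmetric] by simp
  qed
  have c_pos: "0 < c" using N_bounds by (simp add: c_def a_def)
  have lN: "0 < 1 - real l / real N" "0 < 1 - real k / real N"
    "1 - real l / real N < 1 - real k / real N"
    using N_bounds assms by (auto simp: divide_strict_right_mono)
  \<comment> \<open>Both products are \<open>c\<close> divided by a factor, and \<open>k < l\<close>
    makes the factor belonging to \<open>Q * a\<close> the larger one.\<close>
  have "Q * a * (1 - real k / real N) = c" unfolding c_def pred_binomials by (simp only: mult_ac)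
  then have "Q * a = c / (1 - real k / real N)"
    unfolding nonzero_eq_divide_eq[OF less_imp_neq[OF lN(2), symmetric]] .
  moreover have "P * b * (1 - real l / real N) = c" unfolding c pred_binomials by (simp only: mult_ac)
  then have "P * b = c / (1 - real l / real N)"
    unfolding nonzero_eq_divide_eq[OF less_imp_neq[OF lN(1), symmetric]] .
  ultimately have 1: "Q * a < P * b" using lN c_pos by (simp add: divide_strict_left_mono)
  \<comment> \<open>The two differences are separated by
    \<open>(N - 1) choose k \<le> (N - 1) choose (l - 1)\<close>, which uses
    \<open>k \<le> l - 1\<close>.\<close>
  have 2: "Q - b \<le> P - a"
  proof -
    have "Q * (1 - real (l + 1) * real k / real N) \<le> b"
      unfolding Q_def b_def using N_bounds by (intro binomial_diff_ge) auto
    then have "Q - b \<le> Q * (real ((l + 1) * k) / real N)" by (simp add: algebra_simps)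
    also have "\<dots> \<le> Q * (1 - real k / real N)"
    proof -
      have "(l + 1) * k + k \<le> (t + 1) * (l + 1) * k"
        using t_pos k_pos mult_le_mono1[of 2 "t + 1" "(l + 1) * k"] by (simp add: algebra_simps)
      then have "real ((l + 1) * k) + real k \<le> real N" using N_bounds(8) by linarith
      then have "(real ((l + 1) * k) + real k) / real N \<le> 1" using N_pos by (simp only: pos_divide_le_eq mult_1)
      then have "real ((l + 1) * k) / real N \<le> 1 - real k / real N"
        unfolding add_divide_distrib by linarith
      then show ?thesis using PQ_ge by (intro mult_left_mono) auto
    qed
    also have "\<dots> \<le> real ((N - 1) choose (l - 1))"
      unfolding pred_binomials(4)[symmetric] of_nat_le_iff
      using assms N_bounds by (intro binomial_mono) auto
    also have "\<dots> = P - real ((N - 1) choose l)"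
      using pred_binomials by (simp add: right_diff_distrib)
    also have "\<dots> \<le> P - a"
      unfolding a_def by (simp add: binomial_right_mono)
    finally show ?thesis .
  qed
  have "real swapped_bound_i = P * Q + real t * (Q - b) - P * b"
    unfolding real_swapped_bound_i b_def by (simp add: algebra_simps)
  also have "\<dots> < P * Q + real t * (P - a) - Q * a"
    using 1 mult_left_mono[OF 2, of "real t"] by simp
  also have "\<dots> = real bound_i"
    unfolding real_bound_i a_def by (simp add: algebra_simps)
  finally show ?thesis by simp
qed

text \<open>If \<open>k = t\<close>, the two extremal products agree to first order in \<open>1 / N\<close>. The right-hand side below is
  what the third Bonferroni inequality gives for the deficit of \<open>bound_i\<close>; this is where the exceptional
  triples come from.\<close>

lemma second_order_gap:
  assumes kt: "k = t" and ne: "(l, k, t) \<notin> {(1, 1, 1), (2, 1, 1), (3, 1, 1), (2, 2, 2)}"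
  shows "(real t + 1) * real t / Q + (real t)\<^sup>2 / real N <
    (real t + 1) * real t / 2 * ((real l - 1) / (real N - 1)) * (1 - (real t - 1) * (real l - 2) / (3 * (real N - 2)))"
proof (cases "t = 1")
  case True
  \<comment> \<open>For \<open>t = 1\<close> one has \<open>Q = N\<close>, and the claim becomes
    \<open>3 / N < (l - 1) / (N - 1)\<close>. The three excluded triples leave
    \<open>l \<ge> 4\<close>, which suffices.\<close>
  then have l: "4 \<le> l" using ne kt k_le_l t_pos by auto
  have "N choose k = N" using True kt by simp
  then have "Q = real N" by (simp add: Q_def)
  then have "(real t + 1) * real t / Q + (real t)\<^sup>2 / real N = 3 / real N" using True by (simp add: add_divide_distrib[symmetric])
  also have "\<dots> < 3 / (real N - 1)" using N_pos by (intro divide_strict_left_mono) auto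
  also have "\<dots> \<le> (real l - 1) / (real N - 1)" using l N_pos by (intro divide_right_mono) auto
  finally show ?thesis using True by simp
next
  case False
  then have t: "2 \<le> t" using t_pos by simp
  \<comment> \<open>Here \<open>l \<ge> k = t \<ge> 2\<close>, and the excluded triple (2, 2, 2)
    rules out \<open>l = 2\<close>.\<close>
  have l: "3 \<le> l" using ne kt k_le_l t by (cases "t = 2"; cases "l = 2") auto
  have N: "(t + 1) * (t + 1) * (t + 1) * (l + 1) + 1 \<le> N"
  proof -
    have "max (t + 1) k = t + 1" using kt by simp
    then show ?thesis using N_large unfolding kt by (simp only: mult_ac)
  qed
  define s where "s = real t"
  define L where "L = real l"
  have s: "2 \<le> s" and L: "3 \<le> L" using t l by (auto simp: s_def L_def)
  have "real ((t + 1) * (t + 1) * (t + 1) * (l + 1) + 1) \<le> real N" using N by (simp only: of_nat_le_iff)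
  then have N': "(s + 1) * (s + 1) * (s + 1) * (L + 1) + 1 \<le> real N"
    by (simp only: of_nat_add of_nat_mult of_nat_1 s_def L_def)
  \<comment> \<open>For \<open>t \<ge> 2\<close> the term with denominator \<open>Q\<close> is thus
    of second order in \<open>1 / N\<close>.\<close>
  have Q: "real N * (real N - 1) / 2 \<le> Q"
  proof -
    have "N choose 2 \<le> N choose k" using kt t N_bounds by (intro binomial_mono) auto
    moreover have "real (N choose 2) = real N * (real N - 1) / 2"
    proof -
      have "real (N choose 2) = real (N * (N - 1)) / real 2"
        unfolding choose_two by (rule real_of_nat_div) (cases "even N"; auto)
      then show ?thesis using N_bounds by simp
    qed
    ultimately show ?thesis unfolding Q_def by linarith
  qed
  \<comment> \<open>This is the third-order correction; it is small because \<open>N\<close> exceeds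
    \<open>(s + 1)^3 * (L + 1)\<close>.\<close>
  have "(s - 1) * (L - 2) / (3 * (real N - 2)) \<le> 1 / (9 * (s + 1))"
  proof -
    have "(s - 1) * (L - 2) * (9 * (s + 1)) \<le> 3 * (real N - 2)"
    proof -
      define A where "A = (s - 1) * (L - 2) * (3 * (s + 1))"
      define B where "B = (s + 1) * (s + 1) * (s + 1) * (L + 1)"
      have "1 \<le> (s + 1) * (s + 1)" using mult_mono[of 1 "s + 1" 1 "s + 1"] s by simp
      then have "((s - 1) * (L - 2)) * (3 * (s + 1)) + 1 * 1 \<le>
          ((s + 1) * (L - 2)) * ((s + 1) * (s + 1)) + (3 * (s + 1)) * ((s + 1) * (s + 1))"
        using s L by (intro add_mono mult_mono) auto
      also have "\<dots> = B" by (simp add: B_def algebra_simps)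
      finally have "A + 1 \<le> B" by (simp add: A_def)
      moreover have "B + 1 \<le> real N" using N' by (simp only: B_def)
      moreover have e: "(s - 1) * (L - 2) * (9 * (s + 1)) = 3 * A" by (simp add: A_def)
      ultimately show ?thesis unfolding e by simp
    qed
    moreover have "0 < real N - 2" using N_bounds by simp
    ultimately show ?thesis using s by (simp add: divide_simps mult_ac)
  qed
  then have eta: "1 - 1 / (9 * (s + 1)) \<le> 1 - (s - 1) * (L - 2) / (3 * (real N - 2))" by simp
  have "(s + 1) * s / Q \<le> (s + 1) * s / (real N * (real N - 1) / 2)"
    using Q s N_pos PQ_ge(4) by (intro divide_left_mono mult_pos_pos) auto
  also have "\<dots> = 2 * (s + 1) / real N * (s / (real N - 1))" by simp
  finally have q: "(s + 1) * s / Q \<le> 2 * (s + 1) / real N * (s / (real N - 1))" .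
  have "s\<^sup>2 / real N \<le> s\<^sup>2 / (real N - 1)" using N_pos by (intro divide_left_mono) auto
  also have "\<dots> = s * (s / (real N - 1))" by (simp add: power2_eq_square)
  finally have "(s + 1) * s / Q + s\<^sup>2 / real N \<le> 2 * (s + 1) / real N * (s / (real N - 1)) + s * (s / (real N - 1))"
    by (rule add_mono[OF q])
  also have "\<dots> = (s / (real N - 1)) * (s + 2 * (s + 1) / real N)" by (simp add: algebra_simps)
  also have "\<dots> < (s / (real N - 1)) * ((s + 1) * (1 - 1 / (9 * (s + 1))))"
  proof (rule mult_strict_left_mono)
    \<comment> \<open>Without the common factor \<open>s / (N - 1)\<close> the left side is at most
      \<open>s + 1/2\<close>, while the right side equals \<open>s + 8/9\<close>.\<close>
    have "2 * (s + 1) / real N \<le> 1 / 2"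
    proof -
      have "(s + 1) * 4 \<le> (s + 1) * ((s + 1) * (s + 1) * (L + 1))"
      proof (rule mult_left_mono)
        have "1 * 1 * 4 \<le> (s + 1) * (s + 1) * (L + 1)" using s L by (intro mult_mono) auto
        then show "4 \<le> (s + 1) * (s + 1) * (L + 1)" by simp
      qed (use s in auto)
      then have "(s + 1) * 4 \<le> real N" using N' by (simp add: mult_ac)
      then show ?thesis using N_pos by (simp add: field_simps)
    qed
    moreover have "(s + 1) * (1 - 1 / (9 * (s + 1))) = s + 1 - 1 / 9"
    proof -
      have "(s + 1) / (9 * (s + 1)) = 1 / 9" using s by simp
      then show ?thesis by (simp add: right_diff_distrib)
    qed
    ultimately show "s + 2 * (s + 1) / real N < (s + 1) * (1 - 1 / (9 * (s + 1)))" by linarith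
  qed (use s N_pos in simp)
  also have "\<dots> \<le> (s / (real N - 1)) * ((s + 1) * (L - 1) / 2 * (1 - (s - 1) * (L - 2) / (3 * (real N - 2))))"
  proof (intro mult_left_mono mult_mono)
    \<comment> \<open>By \<open>L \<ge> 3\<close> the factor \<open>(L - 1) / 2\<close> is at least
      1.\<close>
    show "s + 1 \<le> (s + 1) * (L - 1) / 2" using s L mult_left_mono[of 2 "L - 1" "s + 1"] by simp
    show "0 \<le> 1 - 1 / (9 * (s + 1))" using s by simp
  qed (use s L N_pos eta in auto)
  also have "\<dots> = (s + 1) * s / 2 * ((L - 1) / (real N - 1)) * (1 - (s - 1) * (L - 2) / (3 * (real N - 2)))"
    by (simp add: mult_ac)
  finally show ?thesis by (simp only: s_def L_def)
qed

text \<open>For \<open>k < t\<close> the leading factor \<open>k + 1\<close> is smaller than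
  \<open>t + 1\<close>, and the threshold separates the products. For \<open>k = t\<close> the
  leading terms tie and the second-order terms decide.\<close>

lemma bound_i_less_bound_ii:
  assumes "k \<le> t" and ne: "(l, k, t) \<notin> {(1, 1, 1), (2, 1, 1), (3, 1, 1), (2, 2, 2)}"
  shows "bound_i < bound_ii"
proof (cases "k = t")
  case False
  then have "real l * (real k + 1) * (1 + real t / Q) < U"
    using assms PQ_ge by (intro estimate_i) auto
  then have "real bound_i < W" using bound_i_le by (rule less_W)
  also have "\<dots> \<le> real bound_ii" using assms(1) by (rule W_le_bound_ii)
  finally show ?thesis by simp
next
  case True
  define d where "d = (real t + 1) * real t / 2 * ((real l - 1) / (real N - 1)) *
    (1 - (real t - 1) * (real l - 2) / (3 * (real N - 2)))"
  have gap: "(real t + 1) * real t / Q + (real t)\<^sup>2 / real N < d"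
    unfolding d_def using True ne by (rule second_order_gap)
  have alternate: "p - z \<le> p * (a - b + c)" if "p * (1 - a + b - c) \<le> z" for p z a b c :: real
    using that by (simp add: algebra_simps)
  have e: "real (t + 1) = real t + 1" "real t + 1 - 1 = real t" "real t + 1 - 2 = real t - 1" by auto
  have "P * (1 - real (t + 1) * real l / real N
      + real (t + 1) * (real (t + 1) - 1) / 2 * (real l * (real l - 1) / (real N * (real N - 1)))
      - real (t + 1) * (real (t + 1) - 1) * (real (t + 1) - 2) / 6 *
        (real l * (real l - 1) * (real l - 2) / (real N * (real N - 1) * (real N - 2))))
      \<le> real ((N - (t + 1)) choose l)"
    unfolding P_def using N_bounds True k_le_l by (intro binomial_diff_ge3) auto
  then have "P - real ((N - (t + 1)) choose l) \<le> P * ((real t + 1) * real l / real N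
      - (real t + 1) * real t / 2 * (real l * (real l - 1) / (real N * (real N - 1)))
      + (real t + 1) * real t * (real t - 1) / 6 *
        (real l * (real l - 1) * (real l - 2) / (real N * (real N - 1) * (real N - 2))))"
    unfolding e by (rule alternate)
  also have "\<dots> = P * real l / real N * (real t + 1 - d)"
  proof -
    define x y z where "x = real l / real N" and "y = (real l - 1) / (real N - 1)" and "z = (real l - 2) / (real N - 2)"
    have "real l * (real l - 1) / (real N * (real N - 1)) = x * y"
      "real l * (real l - 1) * (real l - 2) / (real N * (real N - 1) * (real N - 2)) = x * y * z"
      "(real t + 1) * real l / real N = (real t + 1) * x" "P * real l / real N = P * x"
      "(real t - 1) * (real l - 2) / (3 * (real N - 2)) = (real t - 1) * z / 3"
      by (simp_all add: x_def y_def z_def)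
    moreover have "P * ((real t + 1) * x - (real t + 1) * real t / 2 * (x * y) +
        (real t + 1) * real t * (real t - 1) / 6 * (x * y * z)) =
      P * x * (real t + 1 - (real t + 1) * real t / 2 * y * (1 - (real t - 1) * z / 3))"
      by (simp add: algebra_simps add_divide_distrib diff_divide_distrib)
    ultimately show ?thesis unfolding d_def y_def[symmetric] by (simp only:)
  qed
  finally have le: "P - real ((N - (t + 1)) choose l) \<le> P * real l / real N * (real t + 1 - d)" .
  have "real bound_i = (P - real ((N - (t + 1)) choose l)) * (Q + real t)"
    using real_bound_i by (simp only: True)
  also have "\<dots> \<le> P * real l / real N * (real t + 1 - d) * (Q + real t)"
    using le PQ_ge by (intro mult_right_mono) auto
  also have "\<dots> < P * real l / real N * (Q * (real t + 1 - real t * real t / real N))"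
    unfolding mult.assoc[of "P * real l / real N"]
  proof (rule mult_strict_left_mono)
    \<comment> \<open>Expanded, the goal is the inequality of \<open>second_order_gap\<close>
      multiplied by \<open>Q\<close>, with the nonnegative term \<open>d * t\<close> to
      spare.\<close>
    have "((real t + 1) * real t / Q + (real t)\<^sup>2 / real N) * Q < d * Q"
      using gap PQ_ge by (intro mult_strict_right_mono) auto
    moreover have "((real t + 1) * real t / Q + (real t)\<^sup>2 / real N) * Q =
        (real t + 1) * real t + Q * (real t * real t / real N)"
    proof -
      have "(a / Q + b) * Q = a + Q * b" for a b using PQ_ge(4) by (simp add: distrib_right)
      then show ?thesis unfolding power2_eq_square .
    qed
    ultimately have "(real t + 1) * real t + Q * (real t * real t / real N) < d * Q" by simp
    moreover have "0 \<le> d * real t" using gap PQ_ge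
      by (intro mult_nonneg_nonneg order_trans[OF _ less_imp_le[OF gap]] add_nonneg_nonneg divide_nonneg_nonneg) auto
    ultimately show "(real t + 1 - d) * (Q + real t) < Q * (real t + 1 - real t * real t / real N)"
      by (simp add: algebra_simps)
  qed (use PQ_ge l1 N_pos in simp)
  also have "\<dots> = P * Q / real N * (real l * (real t + 1 - real t * real k / real N))" using True by simp
  also have "\<dots> = real bound_ii" by (rule real_bound_ii[symmetric])
  finally show ?thesis by simp
qed

end

section \<open>Classification of large pairs\<close>

text \<open>The ground set itself is a cover, so a smallest one exists; a member of the nonempty
  family forces it to have at least \<open>t\<close> elements.\<close>

lemma obtain_minimal_t_cover:
  assumes "finite V" "\<F> \<subseteq> [V]\<^bsup>k\<^esup>" "t \<le> k" "\<F> \<noteq> {}"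
  obtains T where "T \<subseteq> V" "t_cover t \<F> T" "t \<le> card T"
    "\<And>S. S \<subseteq> V \<Longrightarrow> t_cover t \<F> S \<Longrightarrow> card T \<le> card S"
proof -
  have "t_cover t \<F> V"
    unfolding t_cover_def
  proof
    fix A assume "A \<in> \<F>"
    then have "A \<subseteq> V" "card A = k" using assms(2) by (auto simp: nsets_def)
    then show "t \<le> card (V \<inter> A)" using assms(3) by (simp add: Int_absorb1)
  qed
  then have "\<exists>T. (T \<subseteq> V \<and> t_cover t \<F> T) \<and> (\<forall>S. S \<subseteq> V \<and> t_cover t \<F> S \<longrightarrow> card T \<le> card S)"
    by (intro ex_has_least_nat[where k = V]) simp
  then obtain T where T: "T \<subseteq> V" "t_cover t \<F> T"
    "\<And>S. S \<subseteq> V \<Longrightarrow> t_cover t \<F> S \<Longrightarrow> card T \<le> card S" by blast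
  obtain A where "A \<in> \<F>" using assms(4) by blast
  then have "t \<le> card (T \<inter> A)" using T(2) by (simp add: t_cover_def)
  also have "\<dots> \<le> card T" using finite_subset[OF T(1) assms(1)] by (intro card_mono) auto
  finally show thesis using T that by blast
qed

lemma t_cover_card_eq:
  assumes "finite X" "card X = t" "t_cover t \<F> X" "F \<in> \<F>"
  shows "X \<subseteq> F"
proof -
  have "card X \<le> card (X \<inter> F)" using assms by (simp add: t_cover_def)
  then have "X \<inter> F = X" using assms(1) by (intro card_seteq) auto
  then show ?thesis by blast
qed

text \<open>A positive product reaches its bound only if both factors do, and finite sets with an
  inclusion and no gap in size are equal.\<close>

lemma product_bound:
  assumes "finite \<S>\<^sub>1" "finite \<S>\<^sub>2" "\<F>\<^sub>1 \<subseteq> \<S>\<^sub>1" "\<F>\<^sub>2 \<subseteq> \<S>\<^sub>2" "card \<S>\<^sub>1 \<le> a" "card \<S>\<^sub>2 \<le> b"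
  shows "card \<F>\<^sub>1 * card \<F>\<^sub>2 \<le> a * b"
    and "card \<F>\<^sub>1 * card \<F>\<^sub>2 = a * b \<Longrightarrow> 0 < a * b \<Longrightarrow> \<F>\<^sub>1 = \<S>\<^sub>1 \<and> \<F>\<^sub>2 = \<S>\<^sub>2"
proof -
  have le: "card \<F>\<^sub>1 \<le> a" "card \<F>\<^sub>2 \<le> b"
    using assms card_mono[OF assms(1,3)] card_mono[OF assms(2,4)] by linarith+
  then show "card \<F>\<^sub>1 * card \<F>\<^sub>2 \<le> a * b" by (rule mult_le_mono)
  assume eq: "card \<F>\<^sub>1 * card \<F>\<^sub>2 = a * b" and pos: "0 < a * b"
  have "card \<F>\<^sub>1 = a"
  proof (rule ccontr)
    assume "card \<F>\<^sub>1 \<noteq> a"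
    then have "card \<F>\<^sub>1 * b < a * b" using le pos by simp
    moreover have "card \<F>\<^sub>1 * card \<F>\<^sub>2 \<le> card \<F>\<^sub>1 * b" using le by (intro mult_le_mono2)
    ultimately show False using eq by linarith
  qed
  moreover from this have "card \<F>\<^sub>2 = b" using eq pos by simp
  ultimately show "\<F>\<^sub>1 = \<S>\<^sub>1 \<and> \<F>\<^sub>2 = \<S>\<^sub>2" 
    using card_seteq[OF assms(1,3)] card_seteq[OF assms(2,4)] assms(5,6) by simp
qed

text \<open>Containments are recorded instead of equalities, since this is what the case analysis
  yields; equality of the families comes later from equality of the products. The sizes
  \<open>p\<close> and \<open>q\<close> allow both orders.\<close>

definition structure_i :: "'a set \<Rightarrow> nat \<Rightarrow> nat \<Rightarrow> nat \<Rightarrow> 'a set \<Rightarrow> 'a set \<Rightarrow> 'a set set \<Rightarrow> 'a set set \<Rightarrow> bool" where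
  "structure_i V p q t X M \<F> \<H> \<longleftrightarrow> X \<in> [V]\<^bsup>t\<^esup> \<and> M \<in> [V]\<^bsup>(q + 1)\<^esup> \<and> X \<subseteq> M \<and>
     \<F> \<subseteq> {F \<in> [V]\<^bsup>p\<^esup>. X \<subseteq> F \<and> t + 1 \<le> card (F \<inter> M)} \<and> \<H> \<subseteq> {F \<in> [V]\<^bsup>q\<^esup>. X \<subseteq> F} \<union> [M]\<^bsup>q\<^esup>"

definition structure_ii :: "'a set \<Rightarrow> nat \<Rightarrow> nat \<Rightarrow> nat \<Rightarrow> 'a set \<Rightarrow> 'a set set \<Rightarrow> 'a set set \<Rightarrow> bool" where
  "structure_ii V p q t T \<F> \<H> \<longleftrightarrow> T \<in> [V]\<^bsup>(t + 1)\<^esup> \<and>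
     \<F> \<subseteq> {F \<in> [V]\<^bsup>p\<^esup>. T \<subseteq> F} \<and> \<H> \<subseteq> {F \<in> [V]\<^bsup>q\<^esup>. t \<le> card (F \<inter> T)}"

lemma structure_i_product:
  assumes S: "structure_i V p q t X M \<F> \<H>" and V: "finite V" "t < p" "t < q"
  defines "b \<equiv> (((card V - t) choose (p - t)) - ((card V - q - 1) choose (p - t))) * (((card V - t) choose (q - t)) + t)"
  shows "card \<F> * card \<H> \<le> b"
    and "card \<F> * card \<H> = b \<Longrightarrow> 0 < b \<Longrightarrow>
      \<F> = {F \<in> [V]\<^bsup>p\<^esup>. X \<subseteq> F \<and> t + 1 \<le> card (F \<inter> M)} \<and> \<H> = {F \<in> [V]\<^bsup>q\<^esup>. X \<subseteq> F} \<union> [M]\<^bsup>q\<^esup>"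
proof -
  have X: "X \<subseteq> M" "M \<subseteq> V" "card X = t" "card M = q + 1" "finite M"
    using S by (auto simp: structure_i_def nsets_def)
  have sub: "\<F> \<subseteq> {F \<in> [V]\<^bsup>p\<^esup>. X \<subseteq> F \<and> t + 1 \<le> card (F \<inter> M)}"
    "\<H> \<subseteq> {F \<in> [V]\<^bsup>q\<^esup>. X \<subseteq> F} \<union> [M]\<^bsup>q\<^esup>"
    using S unfolding structure_i_def by blast+
  have fin: "finite {F \<in> [V]\<^bsup>p\<^esup>. X \<subseteq> F \<and> t + 1 \<le> card (F \<inter> M)}"
    "finite ({F \<in> [V]\<^bsup>q\<^esup>. X \<subseteq> F} \<union> [M]\<^bsup>q\<^esup>)"
    using V(1) X(5) by (simp_all add: finite_imp_finite_nsets)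
  have c1: "card {F \<in> [V]\<^bsup>p\<^esup>. X \<subseteq> F \<and> t + 1 \<le> card (F \<inter> M)} \<le>
      ((card V - t) choose (p - t)) - ((card V - q - 1) choose (p - t))"
    using card_subfamily_meeting[OF V(1) X(2,1), of p] X V by simp
  have c2: "card ({F \<in> [V]\<^bsup>q\<^esup>. X \<subseteq> F} \<union> [M]\<^bsup>q\<^esup>) \<le> ((card V - t) choose (q - t)) + t"
    using card_star_Un_nsets_le[OF V(1) X(2,1,4)] X V by (simp add: star_def)
  show "card \<F> * card \<H> \<le> b"
    unfolding b_def using product_bound(1)[OF fin sub c1 c2] .
  show "\<F> = {F \<in> [V]\<^bsup>p\<^esup>. X \<subseteq> F \<and> t + 1 \<le> card (F \<inter> M)} \<and> \<H> = {F \<in> [V]\<^bsup>q\<^esup>. X \<subseteq> F} \<union> [M]\<^bsup>q\<^esup>"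
    if "card \<F> * card \<H> = b" "0 < b"
    using product_bound(2)[OF fin sub c1 c2] that unfolding b_def by blast
qed

lemma structure_ii_product:
  assumes S: "structure_ii V p q t T \<F> \<H>" and V: "finite V" "t < p" "t < q"
  defines "b \<equiv> ((card V - t - 1) choose (p - t - 1)) *
    ((t + 1) * ((card V - t - 1) choose (q - t)) + ((card V - t - 1) choose (q - t - 1)))"
  shows "card \<F> * card \<H> \<le> b"
    and "card \<F> * card \<H> = b \<Longrightarrow> 0 < b \<Longrightarrow>
      \<F> = {F \<in> [V]\<^bsup>p\<^esup>. T \<subseteq> F} \<and> \<H> = {F \<in> [V]\<^bsup>q\<^esup>. t \<le> card (F \<inter> T)}"
proof -
  have T: "T \<subseteq> V" "card T = t + 1"
    using S by (auto simp: structure_ii_def nsets_def)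
  have sub: "\<F> \<subseteq> {F \<in> [V]\<^bsup>p\<^esup>. T \<subseteq> F}" "\<H> \<subseteq> {F \<in> [V]\<^bsup>q\<^esup>. t \<le> card (F \<inter> T)}"
    using S unfolding structure_ii_def by blast+
  have fin: "finite {F \<in> [V]\<^bsup>p\<^esup>. T \<subseteq> F}" "finite {F \<in> [V]\<^bsup>q\<^esup>. t \<le> card (F \<inter> T)}"
    using V(1) by (simp_all add: finite_imp_finite_nsets)
  have c1: "card {F \<in> [V]\<^bsup>p\<^esup>. T \<subseteq> F} \<le> (card V - t - 1) choose (p - t - 1)"
    using card_superset[OF V(1) T(1), of p] T V by simp
  have c2: "card {F \<in> [V]\<^bsup>q\<^esup>. t \<le> card (F \<inter> T)} \<le>
      (t + 1) * ((card V - t - 1) choose (q - t)) + ((card V - t - 1) choose (q - t - 1))"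
    using card_almost_containing_le[OF V(1) T, of q] V by simp
  show "card \<F> * card \<H> \<le> b"
    unfolding b_def using product_bound(1)[OF fin sub c1 c2] .
  show "\<F> = {F \<in> [V]\<^bsup>p\<^esup>. T \<subseteq> F} \<and> \<H> = {F \<in> [V]\<^bsup>q\<^esup>. t \<le> card (F \<inter> T)}"
    if "card \<F> * card \<H> = b" "0 < b"
    using product_bound(2)[OF fin sub c1 c2] that unfolding b_def by blast
qed

text \<open>Minimal covers of both families are compared. Excesses (0, 0) contradict a large product
  by non-triviality, (1, 0) and (0, 1) lead to \<open>one_sided_trichotomy\<close>, and all others
  are small by \<open>small_cover_bound\<close>.\<close>

lemma small_or_structured:
  assumes V: "finite V" "\<F>\<^sub>1 \<subseteq> [V]\<^bsup>k\<^sub>1\<^esup>" "\<F>\<^sub>2 \<subseteq> [V]\<^bsup>k\<^sub>2\<^esup>"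
    and k: "t < k\<^sub>2" "t < k\<^sub>1"
    and cross: "cross_intersecting t \<F>\<^sub>1 \<F>\<^sub>2" and nontrivial: "\<not> trivial_pair V t \<F>\<^sub>1 \<F>\<^sub>2"
    and size: "size_params (card V - t) (k\<^sub>1 - t) (k\<^sub>2 - t) t"
  shows "real (card \<F>\<^sub>1 * card \<F>\<^sub>2) < size_params.W (card V - t) (k\<^sub>1 - t) (k\<^sub>2 - t) t \<or>
    (\<exists>X M. structure_i V k\<^sub>1 k\<^sub>2 t X M \<F>\<^sub>1 \<F>\<^sub>2) \<or> (\<exists>T. structure_ii V k\<^sub>1 k\<^sub>2 t T \<F>\<^sub>1 \<F>\<^sub>2) \<or>
    (\<exists>X M. structure_i V k\<^sub>2 k\<^sub>1 t X M \<F>\<^sub>2 \<F>\<^sub>1) \<or> (\<exists>T. structure_ii V k\<^sub>2 k\<^sub>1 t T \<F>\<^sub>2 \<F>\<^sub>1)"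
    (is "?small \<or> ?rest")
proof (cases "\<F>\<^sub>1 = {} \<or> \<F>\<^sub>2 = {}")
  \<comment> \<open>An empty family is covered by the empty set, so the size bound on minimal covers
    would fail; its product 0 is below the positive \<open>W\<close>.\<close>
  case True
  interpret size_params "card V - t" "k\<^sub>1 - t" "k\<^sub>2 - t" t by (rule size)
  have "card \<F>\<^sub>1 * card \<F>\<^sub>2 = 0" using True by auto
  then have ?small using W_pos by (simp only: of_nat_0)
  then show ?thesis by blast
next
  case False
  then have ne: "\<F>\<^sub>1 \<noteq> {}" "\<F>\<^sub>2 \<noteq> {}" by auto
  interpret size_params "card V - t" "k\<^sub>1 - t" "k\<^sub>2 - t" t by (rule size)
  have kV: "k\<^sub>1 \<le> card V" "k\<^sub>2 \<le> card V" using N_bounds(1,2) by linarith+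
  have e: "card V - t - (k\<^sub>1 - t) = card V - k\<^sub>1" "card V - t - (k\<^sub>2 - t) = card V - k\<^sub>2" using k by auto
  note cross' = cross_intersecting_sym[OF cross]
  obtain T1 where T1: "T1 \<subseteq> V" "t_cover t \<F>\<^sub>2 T1" "t \<le> card T1"
    and min1: "\<And>S. S \<subseteq> V \<Longrightarrow> t_cover t \<F>\<^sub>2 S \<Longrightarrow> card T1 \<le> card S"
    using obtain_minimal_t_cover[OF V(1,3) less_imp_le[OF k(1)] ne(2)] by blast
  obtain T2 where T2: "T2 \<subseteq> V" "t_cover t \<F>\<^sub>1 T2" "t \<le> card T2"
    and min2: "\<And>S. S \<subseteq> V \<Longrightarrow> t_cover t \<F>\<^sub>1 S \<Longrightarrow> card T2 \<le> card S"
    using obtain_minimal_t_cover[OF V(1,2) less_imp_le[OF k(2)] ne(1)] by blast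
  have fin: "finite T1" "finite T2" using T1(1) T2(1) V(1) by (auto intro: finite_subset)
  define i j where "i = card T1 - t" and "j = card T2 - t"
  have ij: "card T1 = t + i" "card T2 = t + j" using T1 T2 by (auto simp: i_def j_def)
  have "card \<F>\<^sub>1 \<le> (card T2 choose t) * ((k\<^sub>2 - t + 1) ^ i * ((card V - t - i) choose (card V - k\<^sub>1)))"
    using min1 ij k by (intro card_le_via_covers[OF V(1-3) kV(1) _ cross _ T2(1,2)]) auto
  moreover have "card \<F>\<^sub>2 \<le> (card T1 choose t) * ((k\<^sub>1 - t + 1) ^ j * ((card V - t - j) choose (card V - k\<^sub>2)))"
    using min2 ij k by (intro card_le_via_covers[OF V(1,3,2) kV(2) _ cross' _ T1(1,2)]) auto
  ultimately have "card \<F>\<^sub>1 * card \<F>\<^sub>2 \<le>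
      ((card T2 choose t) * ((k\<^sub>2 - t + 1) ^ i * ((card V - t - i) choose (card V - k\<^sub>1)))) *
      ((card T1 choose t) * ((k\<^sub>1 - t + 1) ^ j * ((card V - t - j) choose (card V - k\<^sub>2))))"
    by (rule mult_le_mono)
  \<comment> \<open>The factors \<open>card T1 choose t\<close> and \<open>card T2 choose t\<close>
    change places.\<close>
  also have "\<dots> = cover_bound t (k\<^sub>2 - t) (card V - t) (k\<^sub>1 - t) i * cover_bound t (k\<^sub>1 - t) (card V - t) (k\<^sub>2 - t) j"
    unfolding cover_bound_def ij e by (simp only: mult_ac)
  finally have prod: "card \<F>\<^sub>1 * card \<F>\<^sub>2 \<le> \<dots>" .
  consider "1 \<le> i \<and> 1 \<le> j \<or> 2 \<le> i \<or> 2 \<le> j" | "i = 0" "j = 0" | "i = 1" "j = 0" | "i = 0" "j = 1" by linarith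
  then show ?thesis
  proof cases
    case 1
    then show ?thesis using small_cover_bound[OF prod] by blast
  next
    case 2
    have sup1: "T1 \<subseteq> F" if "F \<in> \<F>\<^sub>2" for F using t_cover_card_eq[OF fin(1) _ T1(2) that] ij 2 by simp
    have sup2: "T2 \<subseteq> F" if "F \<in> \<F>\<^sub>1" for F using t_cover_card_eq[OF fin(2) _ T2(2) that] ij 2 by simp
    have no_common: "\<not> (X \<subseteq> V \<and> card X = t \<and> (\<forall>F\<in>\<F>\<^sub>1. X \<subseteq> F) \<and> (\<forall>F\<in>\<F>\<^sub>2. X \<subseteq> F))" for X
    proof
      assume X: "X \<subseteq> V \<and> card X = t \<and> (\<forall>F\<in>\<F>\<^sub>1. X \<subseteq> F) \<and> (\<forall>F\<in>\<F>\<^sub>2. X \<subseteq> F)"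
      then have "X \<subseteq> V \<inter> (\<Inter>\<F>\<^sub>1 \<inter> \<Inter>\<F>\<^sub>2)" by blast
      then have "card X \<le> card (V \<inter> (\<Inter>\<F>\<^sub>1 \<inter> \<Inter>\<F>\<^sub>2))" using V(1) by (intro card_mono) auto
      then show False using nontrivial X by (simp add: trivial_pair_def)
    qed
    \<comment> \<open>\<open>T2\<close> lies in all of \<open>\<F>\<^sub>1\<close>; being a cover of
      \<open>\<F>\<^sub>2\<close> as well, it would be a common \<open>t\<close>-set of both
      families.\<close>
    have "\<not> t_cover t \<F>\<^sub>2 T2"
      using no_common[of T2] t_cover_card_eq[OF fin(2), of t \<F>\<^sub>2] sup2 T2(1) ij 2 by auto
    then have "card {F \<in> \<F>\<^sub>1. T2 \<subseteq> F} \<le> (k\<^sub>2 - t + 1) * ((card V - t - 1) choose (card V - k\<^sub>1))"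
    proof (rule card_superset_le_step[OF V(1-3) less_imp_le[OF k(1)] cross])
      fix d assume "d \<in> V - T2"
      then have "insert d T2 \<subseteq> V" "card (insert d T2) = t + 1" using T2(1) fin ij 2 by auto
      then show "card {F \<in> \<F>\<^sub>1. insert d T2 \<subseteq> F} \<le> (card V - t - 1) choose (card V - k\<^sub>1)"
        using card_superset_le[OF V(1,2) _ kV(1)] by (metis diff_diff_left)
    qed
    moreover have "{F \<in> \<F>\<^sub>1. T2 \<subseteq> F} = \<F>\<^sub>1" using sup2 by auto
    moreover have "\<not> t_cover t \<F>\<^sub>1 T1"
      using no_common[of T1] t_cover_card_eq[OF fin(1), of t \<F>\<^sub>1] sup1 T1(1) ij 2 by auto
    then have "card {F \<in> \<F>\<^sub>2. T1 \<subseteq> F} \<le> (k\<^sub>1 - t + 1) * ((card V - t - 1) choose (card V - k\<^sub>2))"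
    proof (rule card_superset_le_step[OF V(1,3,2) less_imp_le[OF k(2)] cross'])
      fix d assume "d \<in> V - T1"
      then have "insert d T1 \<subseteq> V" "card (insert d T1) = t + 1" using T1(1) fin ij 2 by auto
      then show "card {F \<in> \<F>\<^sub>2. insert d T1 \<subseteq> F} \<le> (card V - t - 1) choose (card V - k\<^sub>2)"
        using card_superset_le[OF V(1,3) _ kV(2)] by (metis diff_diff_left)
    qed
    moreover have "{F \<in> \<F>\<^sub>2. T1 \<subseteq> F} = \<F>\<^sub>2" using sup1 by auto
    ultimately have ?small by (intro small_single_steps) (simp_all only: e)
    then show ?thesis by blast
  next
    case 3
    have sup2: "T2 \<subseteq> F" if "F \<in> \<F>\<^sub>1" for F using t_cover_card_eq[OF fin(2) _ T2(2) that] ij 3 by simp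
    have c: "card T2 = t" "card T1 = t + 1" using ij 3 by auto
    have sup: "\<forall>F\<in>\<F>\<^sub>1. T2 \<subseteq> F" using sup2 by blast
    have tau1: "\<forall>S\<subseteq>V. t_cover t \<F>\<^sub>1 S \<longrightarrow> t \<le> card S" using min2 c by simp
    have tau2: "\<forall>S\<subseteq>V. t_cover t \<F>\<^sub>2 S \<longrightarrow> t + 1 \<le> card S" using min1 c by simp
    have XV: "T2 \<in> [V]\<^bsup>t\<^esup>" using T2(1) fin c by (simp add: nsets_def)
    show ?thesis
      using one_sided_trichotomy[OF V kV k(2,1) cross T2(1) c(1) sup tau1 tau2 T1(1,2) c(2)]
    proof (elim disjE exE conjE)
      fix M assume "M \<subseteq> V" "card M = k\<^sub>2 + 1" "T2 \<subseteq> M"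
        "\<F>\<^sub>1 \<subseteq> {F \<in> [V]\<^bsup>k\<^sub>1\<^esup>. T2 \<subseteq> F \<and> t + 1 \<le> card (F \<inter> M)}" "\<F>\<^sub>2 \<subseteq> star V k\<^sub>2 T2 \<union> [M]\<^bsup>k\<^sub>2\<^esup>"
      moreover from this have "M \<in> [V]\<^bsup>(k\<^sub>2 + 1)\<^esup>" using V(1) finite_subset[of M V] by (simp add: nsets_def)
      ultimately have "structure_i V k\<^sub>1 k\<^sub>2 t T2 M \<F>\<^sub>1 \<F>\<^sub>2" using XV by (simp add: structure_i_def star_def)
      then show ?thesis by blast
    next
      fix Y assume "Y \<subseteq> V" "card Y = t + 1" "\<F>\<^sub>1 \<subseteq> star V k\<^sub>1 Y" "\<F>\<^sub>2 \<subseteq> {F \<in> [V]\<^bsup>k\<^sub>2\<^esup>. t \<le> card (F \<inter> Y)}"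
      moreover from this have "Y \<in> [V]\<^bsup>(t + 1)\<^esup>" using V(1) finite_subset[of Y V] by (simp add: nsets_def)
      ultimately have "structure_ii V k\<^sub>1 k\<^sub>2 t Y \<F>\<^sub>1 \<F>\<^sub>2" by (simp add: structure_ii_def star_def)
      then show ?thesis by blast
    next
      assume "card \<F>\<^sub>1 \<le> (k\<^sub>2 - t + 1) * ((k\<^sub>2 - t + 1) * ((card V - t - 2) choose (card V - k\<^sub>1)))"
        "card \<F>\<^sub>2 \<le> (t + 1) * ((card V - t) choose (card V - k\<^sub>2))"
      then have ?small unfolding e[symmetric] by (rule small_no_common)
      then show ?thesis by blast
    next
      fix a assume a: "1 \<le> a" "a \<le> k\<^sub>2 - t"
        "card \<F>\<^sub>1 \<le> a * ((card V - t - 1) choose (card V - k\<^sub>1)) +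
          (k\<^sub>2 - t + 1 - a) * ((k\<^sub>2 - t + 1) * ((card V - t - 2) choose (card V - k\<^sub>1)))"
        "card \<F>\<^sub>2 \<le> ((card V - t) choose (card V - k\<^sub>2)) +
          t * ((k\<^sub>1 - t) * ((card V - t - 1) choose (card V - k\<^sub>2)))"
      then have ?small unfolding e[symmetric] by (rule small_mid)
      then show ?thesis by blast
    qed
  next
    case 4
    have sup1: "T1 \<subseteq> F" if "F \<in> \<F>\<^sub>2" for F using t_cover_card_eq[OF fin(1) _ T1(2) that] ij 4 by simp
    have c: "card T1 = t" "card T2 = t + 1" using ij 4 by auto
    have sup: "\<forall>F\<in>\<F>\<^sub>2. T1 \<subseteq> F" using sup1 by blast
    have tau1: "\<forall>S\<subseteq>V. t_cover t \<F>\<^sub>2 S \<longrightarrow> t \<le> card S" using min1 c by simp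
    have tau2: "\<forall>S\<subseteq>V. t_cover t \<F>\<^sub>1 S \<longrightarrow> t + 1 \<le> card S" using min2 c by simp
    have XV: "T1 \<in> [V]\<^bsup>t\<^esup>" using T1(1) fin c by (simp add: nsets_def)
    show ?thesis
      using one_sided_trichotomy[OF V(1,3,2) kV(2,1) k(1,2) cross' T1(1) c(1) sup tau1 tau2 T2(1,2) c(2)]
    proof (elim disjE exE conjE)
      fix M assume "M \<subseteq> V" "card M = k\<^sub>1 + 1" "T1 \<subseteq> M"
        "\<F>\<^sub>2 \<subseteq> {F \<in> [V]\<^bsup>k\<^sub>2\<^esup>. T1 \<subseteq> F \<and> t + 1 \<le> card (F \<inter> M)}" "\<F>\<^sub>1 \<subseteq> star V k\<^sub>1 T1 \<union> [M]\<^bsup>k\<^sub>1\<^esup>"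
      moreover from this have "M \<in> [V]\<^bsup>(k\<^sub>1 + 1)\<^esup>" using V(1) finite_subset[of M V] by (simp add: nsets_def)
      ultimately have "structure_i V k\<^sub>2 k\<^sub>1 t T1 M \<F>\<^sub>2 \<F>\<^sub>1" using XV by (simp add: structure_i_def star_def)
      then show ?thesis by blast
    next
      fix Y assume "Y \<subseteq> V" "card Y = t + 1" "\<F>\<^sub>2 \<subseteq> star V k\<^sub>2 Y" "\<F>\<^sub>1 \<subseteq> {F \<in> [V]\<^bsup>k\<^sub>1\<^esup>. t \<le> card (F \<inter> Y)}"
      moreover from this have "Y \<in> [V]\<^bsup>(t + 1)\<^esup>" using V(1) finite_subset[of Y V] by (simp add: nsets_def)
      ultimately have "structure_ii V k\<^sub>2 k\<^sub>1 t Y \<F>\<^sub>2 \<F>\<^sub>1" by (simp add: structure_ii_def star_def)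
      then show ?thesis by blast
    next
      assume "card \<F>\<^sub>2 \<le> (k\<^sub>1 - t + 1) * ((k\<^sub>1 - t + 1) * ((card V - t - 2) choose (card V - k\<^sub>2)))"
        "card \<F>\<^sub>1 \<le> (t + 1) * ((card V - t) choose (card V - k\<^sub>1))"
      then have ?small unfolding e[symmetric] by (rule small_no_common_swapped)
      then show ?thesis by blast
    next
      fix a assume a: "1 \<le> a" "a \<le> k\<^sub>1 - t"
        "card \<F>\<^sub>2 \<le> a * ((card V - t - 1) choose (card V - k\<^sub>2)) +
          (k\<^sub>1 - t + 1 - a) * ((k\<^sub>1 - t + 1) * ((card V - t - 2) choose (card V - k\<^sub>2)))"
        "card \<F>\<^sub>1 \<le> ((card V - t) choose (card V - k\<^sub>1)) +
          t * ((k\<^sub>2 - t) * ((card V - t - 1) choose (card V - k\<^sub>1)))"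
      then have ?small unfolding e[symmetric] by (rule small_mid_swapped)
      then show ?thesis by blast
    qed
  qed
qed

section \<open>The product bounds and their cases of equality\<close>

theorem theorem1p3:
  fixes n k\<^sub>1 k\<^sub>2 t :: nat
    and \<F>\<^sub>1 \<F>\<^sub>2 :: "nat set set"
  assumes pos: "0 < n" "0 < k\<^sub>1" "0 < k\<^sub>2" "0 < t"
    and n_ge: "n \<ge> max (t + 1) (k\<^sub>2 - t) * (t + 1) * (k\<^sub>1 - t + 1) * (k\<^sub>2 - t + 1) + t + 1"
    and k_ge: "k\<^sub>1 \<ge> k\<^sub>2" "k\<^sub>2 \<ge> t + 1"
    and not_exceptional: "(k\<^sub>1, k\<^sub>2, t) \<notin> {(2, 2, 1), (3, 2, 1), (4, 2, 1), (4, 4, 2)}"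
    and families: "\<F>\<^sub>1 \<subseteq> [{1..n}]\<^bsup>k\<^sub>1\<^esup>" "\<F>\<^sub>2 \<subseteq> [{1..n}]\<^bsup>k\<^sub>2\<^esup>"
    and cross: "cross_intersecting t \<F>\<^sub>1 \<F>\<^sub>2"
    and nontrivial: "\<not> trivial_pair {1..n} t \<F>\<^sub>1 \<F>\<^sub>2"
  shows
    "(k\<^sub>2 \<ge> 2 * t + 1 \<longrightarrow>
        (let bound = (int ((n - t) choose (k\<^sub>1 - t)) - int ((n - k\<^sub>2 - 1) choose (k\<^sub>1 - t)))
                       * (int ((n - t) choose (k\<^sub>2 - t)) + int t)
         in int (card \<F>\<^sub>1) * int (card \<F>\<^sub>2) \<le> bound \<and>
            (int (card \<F>\<^sub>1) * int (card \<F>\<^sub>2) = bound \<longrightarrow>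
              (\<exists>X M. X \<in> [{1..n}]\<^bsup>t\<^esup> \<and> M \<in> [{1..n}]\<^bsup>(k\<^sub>2 + 1)\<^esup> \<and> X \<subseteq> M \<and>
                (\<F>\<^sub>1 = {F \<in> [{1..n}]\<^bsup>k\<^sub>1\<^esup>. X \<subseteq> F \<and> card (F \<inter> M) \<ge> t + 1} \<and>
                 \<F>\<^sub>2 = {F \<in> [{1..n}]\<^bsup>k\<^sub>2\<^esup>. X \<subseteq> F} \<union> [M]\<^bsup>k\<^sub>2\<^esup>
                 \<or>
                 k\<^sub>1 = k\<^sub>2 \<and>
                 \<F>\<^sub>1 = {F \<in> [{1..n}]\<^bsup>k\<^sub>1\<^esup>. X \<subseteq> F} \<union> [M]\<^bsup>k\<^sub>1\<^esup> \<and>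
                 \<F>\<^sub>2 = {F \<in> [{1..n}]\<^bsup>k\<^sub>2\<^esup>. X \<subseteq> F \<and> card (F \<inter> M) \<ge> t + 1})))))
     \<and>
     (t + 1 \<le> k\<^sub>2 \<and> k\<^sub>2 \<le> 2 * t \<longrightarrow>
        (let bound = ((n - t - 1) choose (k\<^sub>1 - t - 1))
                       * ((t + 1) * ((n - t - 1) choose (k\<^sub>2 - t))
                          + ((n - t - 1) choose (k\<^sub>2 - t - 1)))
         in card \<F>\<^sub>1 * card \<F>\<^sub>2 \<le> bound \<and>
            (card \<F>\<^sub>1 * card \<F>\<^sub>2 = bound \<longrightarrow>
              (\<exists>T. T \<in> [{1..n}]\<^bsup>(t + 1)\<^esup> \<and>
                (\<F>\<^sub>1 = {F \<in> [{1..n}]\<^bsup>k\<^sub>1\<^esup>. T \<subseteq> F} \<and>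
                 \<F>\<^sub>2 = {F \<in> [{1..n}]\<^bsup>k\<^sub>2\<^esup>. card (F \<inter> T) \<ge> t}
                 \<or>
                 k\<^sub>1 = k\<^sub>2 \<and>
                 \<F>\<^sub>1 = {F \<in> [{1..n}]\<^bsup>k\<^sub>1\<^esup>. card (F \<inter> T) \<ge> t} \<and>
                 \<F>\<^sub>2 = {F \<in> [{1..n}]\<^bsup>k\<^sub>2\<^esup>. T \<subseteq> F})))))"
proof -
  define N l k where "N = n - t" and "l = k\<^sub>1 - t" and "k = k\<^sub>2 - t"
  have size: "size_params N l k t"
  proof
    show "max (t + 1) k * (t + 1) * (l + 1) * (k + 1) + 1 \<le> N"
      using n_ge unfolding N_def l_def k_def by linarith
  qed (use pos k_ge in \<open>auto simp: l_def k_def\<close>)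
  then interpret size_params N l k t .
  have V: "finite {1..n}" and t: "t < k\<^sub>1" "t < k\<^sub>2" using k_ge by auto
  have lk: "k\<^sub>1 = k\<^sub>2" if "l = k" using that t by (simp add: l_def k_def)
  have kl: "k < l" if "l \<noteq> k" using that k_le_l by simp
  have nk: "n - k\<^sub>2 - 1 = N - k - 1" "n - k\<^sub>1 - 1 = N - l - 1" using t by (auto simp: N_def l_def k_def)
  have bi: "bound_i = (((n - t) choose (k\<^sub>1 - t)) - ((n - k\<^sub>2 - 1) choose (k\<^sub>1 - t))) * (((n - t) choose (k\<^sub>2 - t)) + t)"
    by (simp only: bound_i_def N_def[symmetric] l_def[symmetric] k_def[symmetric] nk)
  have sbi: "swapped_bound_i = (((n - t) choose (k\<^sub>2 - t)) - ((n - k\<^sub>1 - 1) choose (k\<^sub>2 - t))) * (((n - t) choose (k\<^sub>1 - t)) + t)"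
    by (simp only: swapped_bound_i_def N_def[symmetric] l_def[symmetric] k_def[symmetric] nk)
  have bii: "bound_ii = ((n - t - 1) choose (k\<^sub>1 - t - 1)) *
      ((t + 1) * ((n - t - 1) choose (k\<^sub>2 - t)) + ((n - t - 1) choose (k\<^sub>2 - t - 1)))"
    by (simp only: bound_ii_def N_def[symmetric] l_def[symmetric] k_def[symmetric])
  have sbii: "swapped_bound_ii = ((n - t - 1) choose (k\<^sub>2 - t - 1)) *
      ((t + 1) * ((n - t - 1) choose (k\<^sub>1 - t)) + ((n - t - 1) choose (k\<^sub>1 - t - 1)))"
    by (simp only: swapped_bound_ii_def N_def[symmetric] l_def[symmetric] k_def[symmetric])
  let ?p = "card \<F>\<^sub>1 * card \<F>\<^sub>2"
  have p': "card \<F>\<^sub>2 * card \<F>\<^sub>1 = ?p" by (rule mult.commute)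
  have c: "card {1..n} = n" by simp
  \<comment> \<open>Each part of the theorem runs through these five outcomes; all but those
    matching its extremal families give a strictly smaller product.\<close>
  consider (small) "real ?p < W"
    | (i) X M where "structure_i {1..n} k\<^sub>1 k\<^sub>2 t X M \<F>\<^sub>1 \<F>\<^sub>2"
    | (ii) T where "structure_ii {1..n} k\<^sub>1 k\<^sub>2 t T \<F>\<^sub>1 \<F>\<^sub>2"
    | (swapped_i) X M where "structure_i {1..n} k\<^sub>2 k\<^sub>1 t X M \<F>\<^sub>2 \<F>\<^sub>1"
    | (swapped_ii) T where "structure_ii {1..n} k\<^sub>2 k\<^sub>1 t T \<F>\<^sub>2 \<F>\<^sub>1"
    using small_or_structured[OF V families t(2,1) cross nontrivial] size
    unfolding c N_def l_def k_def by blast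
  note outcome = this
  note product_i = structure_i_product[OF _ V t, unfolded c, folded bi]
  note product_ii = structure_ii_product[OF _ V t, unfolded c, folded bii]
  note product_swapped_i = structure_i_product[OF _ V t(2,1), unfolded c, folded sbi]
  note product_swapped_ii = structure_ii_product[OF _ V t(2,1), unfolded c, folded sbii]
  have struct: "X \<in> [{1..n}]\<^bsup>t\<^esup> \<and> M \<in> [{1..n}]\<^bsup>(q + 1)\<^esup> \<and> X \<subseteq> M" if "structure_i {1..n} p q t X M \<F> \<H>" for p q X M \<F> \<H>
    using that unfolding structure_i_def by blast
  have struct': "T \<in> [{1..n}]\<^bsup>(t + 1)\<^esup>" if "structure_ii {1..n} p q t T \<F> \<H>" for p q T \<F> \<H>
    using that unfolding structure_ii_def by blast
  have less_W_if: "real ?p < W" if "?p \<le> x" "real x < W" for x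
    using of_nat_mono[OF that(1)] that(2) by (rule le_less_trans)
  let ?E1 = "\<exists>X M. X \<in> [{1..n}]\<^bsup>t\<^esup> \<and> M \<in> [{1..n}]\<^bsup>(k\<^sub>2 + 1)\<^esup> \<and> X \<subseteq> M \<and>
                (\<F>\<^sub>1 = {F \<in> [{1..n}]\<^bsup>k\<^sub>1\<^esup>. X \<subseteq> F \<and> card (F \<inter> M) \<ge> t + 1} \<and>
                 \<F>\<^sub>2 = {F \<in> [{1..n}]\<^bsup>k\<^sub>2\<^esup>. X \<subseteq> F} \<union> [M]\<^bsup>k\<^sub>2\<^esup>
                 \<or>
                 k\<^sub>1 = k\<^sub>2 \<and>
                 \<F>\<^sub>1 = {F \<in> [{1..n}]\<^bsup>k\<^sub>1\<^esup>. X \<subseteq> F} \<union> [M]\<^bsup>k\<^sub>1\<^esup> \<and>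
                 \<F>\<^sub>2 = {F \<in> [{1..n}]\<^bsup>k\<^sub>2\<^esup>. X \<subseteq> F \<and> card (F \<inter> M) \<ge> t + 1})"
  let ?E2 = "\<exists>T. T \<in> [{1..n}]\<^bsup>(t + 1)\<^esup> \<and>
                (\<F>\<^sub>1 = {F \<in> [{1..n}]\<^bsup>k\<^sub>1\<^esup>. T \<subseteq> F} \<and>
                 \<F>\<^sub>2 = {F \<in> [{1..n}]\<^bsup>k\<^sub>2\<^esup>. card (F \<inter> T) \<ge> t}
                 \<or>
                 k\<^sub>1 = k\<^sub>2 \<and>
                 \<F>\<^sub>1 = {F \<in> [{1..n}]\<^bsup>k\<^sub>1\<^esup>. card (F \<inter> T) \<ge> t} \<and>
                 \<F>\<^sub>2 = {F \<in> [{1..n}]\<^bsup>k\<^sub>2\<^esup>. T \<subseteq> F})"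
  have part_i: "?p \<le> bound_i \<and> (?p = bound_i \<longrightarrow> ?E1)" if "k\<^sub>2 \<ge> 2 * t + 1"
  proof -
    have tk: "t + 1 \<le> k" using that by (simp add: k_def)
    have W: "W \<le> real bound_i" using tk by (rule W_le_bound_i)
    \<comment> \<open>Positivity is what lets equality of the products force equality of the
      families.\<close>
    then have pos: "0 < bound_i" using W_pos by simp
    have strict: ?thesis if "?p < bound_i" using that by simp
    have strict_W: ?thesis if "real ?p < W"
      using less_le_trans[OF that W] unfolding of_nat_less_iff by (rule strict)
    show ?thesis
    proof (cases rule: outcome)
      case small
      then show ?thesis by (rule strict_W)
    next
      case (i X M)
      then have "?E1" if "?p = bound_i" using product_i(2)[OF i that pos] struct[OF i] by blast
      then show ?thesis using product_i(1)[OF i] by blast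
    next
      case (ii T)
      show ?thesis by (intro strict_W less_W_if[OF product_ii(1)[OF ii] bound_ii_small(1)[OF tk]])
    next
      case (swapped_i X M)
      show ?thesis
      \<comment> \<open>For equal sizes the exchanged configuration is alternative (b) and has the
        same bound; for \<open>k < l\<close> its product is strictly smaller.\<close>
      proof (cases "l = k")
        case True
        then have e: "swapped_bound_i = bound_i" unfolding bound_i_def swapped_bound_i_def by simp
        have "?E1" if "?p = bound_i"
        proof -
          have "card \<F>\<^sub>2 * card \<F>\<^sub>1 = swapped_bound_i" "0 < swapped_bound_i" using that p' e pos by simp_all
          note product_swapped_i(2)[OF swapped_i this]
          with struct[OF swapped_i] lk[OF True] show ?thesis by blast
        qed
        then show ?thesis using product_swapped_i(1)[OF swapped_i] e p' by simp
      next
        case False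
        then show ?thesis
          using product_swapped_i(1)[OF swapped_i] swapped_bound_i_less[OF tk kl] p' by (intro strict) simp
      qed
    next
      case (swapped_ii T)
      show ?thesis
        by (intro strict_W less_W_if[OF product_swapped_ii(1)[OF swapped_ii, unfolded p'] bound_ii_small(2)[OF tk]])
    qed
  qed
  have part_ii: "?p \<le> bound_ii \<and> (?p = bound_ii \<longrightarrow> ?E2)" if "k\<^sub>2 \<le> 2 * t"
  proof -
    have kt: "k \<le> t" using that by (simp add: k_def)
    have W: "W \<le> real bound_ii" using kt by (rule W_le_bound_ii)
    then have pos: "0 < bound_ii" using W_pos by simp
    have strict: ?thesis if "?p < bound_ii" using that by simp
    have strict_W: ?thesis if "real ?p < W"
      using less_le_trans[OF that W] unfolding of_nat_less_iff by (rule strict)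
    \<comment> \<open>These are the excluded triples of the theorem with \<open>t\<close> subtracted
      from the two set sizes.\<close>
    have "(l, k, t) \<notin> {(1, 1, 1), (2, 1, 1), (3, 1, 1), (2, 2, 2)}"
      using not_exceptional t by (auto simp: l_def k_def)
    then have less: "bound_i < bound_ii" by (rule bound_i_less_bound_ii[OF kt])
    show ?thesis
    proof (cases rule: outcome)
      case small
      then show ?thesis by (rule strict_W)
    next
      case (i X M)
      then show ?thesis using product_i(1)[OF i] less by (intro strict) simp
    next
      case (ii T)
      then have "?E2" if "?p = bound_ii" using product_ii(2)[OF ii that pos] struct'[OF ii] by blast
      then show ?thesis using product_ii(1)[OF ii] by blast
    next
      case (swapped_i X M)
      have "swapped_bound_i < bound_ii"
      proof (cases "l = k")
        case True
        then have "swapped_bound_i = bound_i" unfolding bound_i_def swapped_bound_i_def by simp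
        then show ?thesis using less by simp
      next
        case False
        have "real swapped_bound_i < real bound_ii"
          by (rule less_le_trans[OF swapped_small(2)[OF kt kl[OF False]] W])
        then show ?thesis by simp
      qed
      then show ?thesis using product_swapped_i(1)[OF swapped_i] p' by (intro strict) simp
    next
      case (swapped_ii T)
      show ?thesis
      proof (cases "l = k")
        case True
        then have e: "swapped_bound_ii = bound_ii" unfolding bound_ii_def swapped_bound_ii_def by simp
        have "?E2" if "?p = bound_ii"
        proof -
          have "card \<F>\<^sub>2 * card \<F>\<^sub>1 = swapped_bound_ii" "0 < swapped_bound_ii" using that p' e pos by simp_all
          note product_swapped_ii(2)[OF swapped_ii this]
          with struct'[OF swapped_ii] lk[OF True] show ?thesis by blast
        qed
        then show ?thesis using product_swapped_ii(1)[OF swapped_ii] e p' by simp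
      next
        case False
        show ?thesis
          by (intro strict_W less_W_if[OF product_swapped_ii(1)[OF swapped_ii, unfolded p'] swapped_small(1)[OF kt kl[OF False]]])
      qed
    qed
  qed
  \<comment> \<open>Binomial coefficients increase with the upper index, so truncated and integer
    subtraction agree.\<close>
  have bi': "int bound_i = (int ((n - t) choose (k\<^sub>1 - t)) - int ((n - k\<^sub>2 - 1) choose (k\<^sub>1 - t)))
      * (int ((n - t) choose (k\<^sub>2 - t)) + int t)"
    unfolding bi using binomial_right_mono[of "n - k\<^sub>2 - 1" "n - t" "k\<^sub>1 - t"] t
    by (simp add: of_nat_diff)
  show ?thesis
    unfolding Let_def bi'[symmetric] bii[symmetric]
    unfolding of_nat_mult[symmetric] of_nat_le_iff of_nat_eq_iff
    using part_i part_ii by blast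
qed

end
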